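(* Let $K$ be a number field with ring of integers $\mathcal{O}_K$, and let $E$ be the Legendre elliptic curve $y^2=x(x+1)(x+\lambda)$ over $K$ for some $\lambda\in\mathcal{O}_K$, $\lambda\neq0,1$. Assume $n\geq 4$ is an even integer. For each root $u$ of $X^n-\lambda$ in a fixed algebraic closure of $K$, put $$P_u=\left(u,\;u(u+1)\sqrt{\frac{u^{n-1}+1}{u+1}}\right),\qquad L_u=K\left(u,\sqrt{\frac{u^{n-1}+1}{u+1}}\right).$$ Then: (1) there exists a finite solvable extension $K'\supset K$ such that $E(K')$ has $n$ $K'$-rational points, namely the points $P_u$ with $u$ ranging over the roots of $X^n-\lambda$; (2) if for every root $u$ of $X^n-\lambda$ there are prime ideals $\mathfrak{p},\mathfrak{q}$ of $\mathcal{O}_{L_u}$ not lying over $(2)\subset\mathbb{Z}$ such that (a) $E$ has good reduction at $\mathfrak{p},\mathfrak{q}$, (b) $\sqrt{\frac{u^{n-1}+1}{u+1}}\in\mathfrak{p}\cap\mathfrak{q}$, and (c) $u,(u+1)\notin\mathfrak{p}\cup\mathfrak{q}$, then these points $P_u$ are all of infinite order in $E(K')$.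
   Context: $\mathcal{O}_{L_u}$ is the ring of integers of $L_u$. The symbol $\sqrt{\frac{u^{n-1}+1}{u+1}}$ denotes a chosen square root, in the fixed algebraic closure, of $\frac{u^{n-1}+1}{u+1}=\sum_{i=0}^{n-2}(-1)^iu^i$ (note $u\neq-1$ since $u^n=\lambda\neq1$ and $n$ is even). Each $P_u$ lies on $E$ because $u^n=\lambda$. A finite extension $K'/K$ is solvable if its Galois closure over $K$ has solvable Galois group.
   Formalization: In (2) the primes p and q are also required to lie over different rational primes; without this the claim fails, e.g. n=6, u a root of X^6-2X^5+3X^4+3X^2-2X+1, λ=u^6, K=Q(λ) (or K(√d) to make p≠q), where P_u is torsion. *)

theory Defs
  imports
    "HOL-Algebra.Algebraic_Closure_Type"
    "HOL-Algebra.Generated_Fields"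
    "HOL-Algebra.Solvable_Groups"
    "HOL-Algebra.Bij"
begin

(* All fields live inside one type 'a, the fixed algebraic closure; a field is a subset of it.
   Kbar is the library's ring record on the whole type. *)
abbreviation Kbar :: "'a::field_char_0 ring" where
  "Kbar \<equiv> ring_of_type_algebra"


section \<open>Number fields, extensions, Galois groups\<close>

definition number_field :: "'a::field_char_0 set \<Rightarrow> bool" where
  "number_field K \<longleftrightarrow> subfield K Kbar \<and> ring.finite_dimension Kbar \<rat> K"

definition ring_of_integers :: "'a::field_char_0 set \<Rightarrow> 'a set" where
  "ring_of_integers K = {x \<in> K. algebraic_int x}"

definition finite_ext :: "'a::field_char_0 set \<Rightarrow> 'a set \<Rightarrow> bool" where
  "finite_ext K F \<longleftrightarrow>
     subfield K Kbar \<and> subfield F Kbar \<and> K \<subseteq> F \<and> ring.finite_dimension Kbar K F"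

(* Every polynomial irreducible over K with a root in M has all its roots (taken in 'a) in M. *)
definition normal_ext :: "'a::field_char_0 set \<Rightarrow> 'a set \<Rightarrow> bool" where
  "normal_ext K M \<longleftrightarrow>
     (\<forall>f \<in> carrier (univ_poly Kbar K).
        pirreducible\<^bsub>Kbar\<^esub> K f \<and> (\<exists>x \<in> M. ring.eval Kbar f x = 0)
        \<longrightarrow> (\<forall>y. ring.eval Kbar f y = 0 \<longrightarrow> y \<in> M))"

(* Separability is automatic in characteristic 0. *)
definition galois_closure :: "'a::field_char_0 set \<Rightarrow> 'a set \<Rightarrow> 'a set" where
  "galois_closure K F = \<Inter> {M. subfield M Kbar \<and> F \<subseteq> M \<and> normal_ext K M}"

definition galois_group :: "'a::field_char_0 set \<Rightarrow> 'a set \<Rightarrow> ('a \<Rightarrow> 'a) monoid" where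
  "galois_group K M =
     (BijGroup M)\<lparr>carrier :=
        {\<sigma> \<in> ring_hom (Kbar\<lparr>carrier := M\<rparr>) (Kbar\<lparr>carrier := M\<rparr>) \<inter> Bij M. \<forall>x \<in> K. \<sigma> x = x}\<rparr>"

definition finite_solvable_ext :: "'a::field_char_0 set \<Rightarrow> 'a set \<Rightarrow> bool" where
  "finite_solvable_ext K F \<longleftrightarrow>
     finite_ext K F \<and> solvable (galois_group K (galois_closure K F))"


section \<open>Primes of a number field\<close>

(* The zero ideal is excluded: reduction only makes sense at a finite place. *)
definition prime_of :: "'a::field_char_0 set \<Rightarrow> 'a set \<Rightarrow> bool" where
  "prime_of L p \<longleftrightarrow> primeideal p (Kbar\<lparr>carrier := ring_of_integers L\<rparr>) \<and> p \<noteq> {0}"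

(* p lies over the ideal (a) of the integers.  Two primes p, q have different residue
   characteristics iff their contractions p \<inter> \<int> and q \<inter> \<int> differ.  The two primes of the
   theorem are read in this sense: if both may lie over the same rational prime, the claim
   fails, e.g. for n = 6, u a root of X^6 - 2X^5 + 3X^4 + 3X^2 - 2X + 1, lam = u^6, K = Q(lam),
   where the point over u has order 6. *)
definition lies_over :: "'a::field_char_0 set \<Rightarrow> int \<Rightarrow> bool" where
  "lies_over p a \<longleftrightarrow> p \<inter> \<int> = {of_int (a * k) | k. True}"

definition local_ring :: "'a::field_char_0 set \<Rightarrow> 'a set \<Rightarrow> 'a set" where
  "local_ring L p = {a / b | a b. a \<in> ring_of_integers L \<and> b \<in> ring_of_integers L \<and> b \<notin> p}"


section \<open>Weierstrass curves\<close>

(* y^2 + a1 x y + a3 y = x^3 + a2 x^2 + a4 x + a6 *)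
datatype 'a weierstrass = Weierstrass (a1: 'a) (a2: 'a) (a3: 'a) (a4: 'a) (a6: 'a)

definition weierstrass_disc :: "'a::field weierstrass \<Rightarrow> 'a" where
  "weierstrass_disc W =
     (let b2 = (a1 W)\<^sup>2 + 4 * a2 W;
          b4 = 2 * a4 W + a1 W * a3 W;
          b6 = (a3 W)\<^sup>2 + 4 * a6 W;
          b8 = (a1 W)\<^sup>2 * a6 W + 4 * a2 W * a6 W - a1 W * a3 W * a4 W
               + a2 W * (a3 W)\<^sup>2 - (a4 W)\<^sup>2
      in - b2\<^sup>2 * b8 - 8 * b4 ^ 3 - 27 * b6\<^sup>2 + 9 * b2 * b4 * b6)"

(* W' arises from W by the substitution x = u^2 x' + r, y = u^3 y' + s u^2 x' + t over L. *)
definition weierstrass_iso :: "'a::field set \<Rightarrow> 'a weierstrass \<Rightarrow> 'a weierstrass \<Rightarrow> bool" where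
  "weierstrass_iso L W W' \<longleftrightarrow>
     (\<exists>u \<in> L. \<exists>r \<in> L. \<exists>s \<in> L. \<exists>t \<in> L. u \<noteq> 0 \<and>
        u * a1 W' = a1 W + 2 * s \<and>
        u ^ 2 * a2 W' = a2 W - s * a1 W + 3 * r - s\<^sup>2 \<and>
        u ^ 3 * a3 W' = a3 W + r * a1 W + 2 * t \<and>
        u ^ 4 * a4 W' = a4 W - s * a3 W + 2 * r * a2 W - (t + r * s) * a1 W + 3 * r\<^sup>2 - 2 * s * t \<and>
        u ^ 6 * a6 W' = a6 W + r * a4 W + r\<^sup>2 * a2 W + r ^ 3 - t * a3 W - t\<^sup>2 - r * t * a1 W)"

(* Some Weierstrass model over L is integral at p with discriminant a unit at p,
   i.e. its reduction modulo p is nonsingular. *)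
definition good_reduction :: "'a::field_char_0 weierstrass \<Rightarrow> 'a set \<Rightarrow> 'a set \<Rightarrow> bool" where
  "good_reduction W L p \<longleftrightarrow>
     (\<exists>W'. weierstrass_iso L W W' \<and>
        {a1 W', a2 W', a3 W', a4 W', a6 W'} \<subseteq> local_ring L p \<and>
        weierstrass_disc W' \<noteq> 0 \<and> inverse (weierstrass_disc W') \<in> local_ring L p)"

datatype 'a point = Infinity | Affine 'a 'a

fun on_curve :: "'a::field weierstrass \<Rightarrow> 'a point \<Rightarrow> bool" where
  "on_curve W Infinity \<longleftrightarrow> True"
| "on_curve W (Affine x y) \<longleftrightarrow>
     y\<^sup>2 + a1 W * x * y + a3 W * y = x ^ 3 + a2 W * x\<^sup>2 + a4 W * x + a6 W"

(* Chord-tangent law; y = l x + m is the chord, or the tangent when both points coincide. *)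
fun point_add :: "'a::field weierstrass \<Rightarrow> 'a point \<Rightarrow> 'a point \<Rightarrow> 'a point" where
  "point_add W Infinity Q = Q"
| "point_add W P Infinity = P"
| "point_add W (Affine x1 y1) (Affine x2 y2) =
     (if x1 = x2 \<and> y1 + y2 + a1 W * x2 + a3 W = 0 then Infinity
      else
        let l = (if x1 \<noteq> x2 then (y2 - y1) / (x2 - x1)
                 else (3 * x1\<^sup>2 + 2 * a2 W * x1 + a4 W - a1 W * y1) / (2 * y1 + a1 W * x1 + a3 W));
            m = y1 - l * x1;
            x3 = l\<^sup>2 + a1 W * l - a2 W - x1 - x2
        in Affine x3 (- (l + a1 W) * x3 - m - a3 W))"

definition rational_points :: "'a::field weierstrass \<Rightarrow> 'a set \<Rightarrow> 'a point set" where
  "rational_points W F =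
     {P. on_curve W P \<and> (\<forall>x y. P = Affine x y \<longrightarrow> x \<in> F \<and> y \<in> F)}"

definition point_group :: "'a::field weierstrass \<Rightarrow> 'a set \<Rightarrow> 'a point monoid" where
  "point_group W F = \<lparr>carrier = rational_points W F, monoid.mult = point_add W, one = Infinity\<rparr>"

definition infinite_order :: "('g, 'm) monoid_scheme \<Rightarrow> 'g \<Rightarrow> bool" where
  "infinite_order G g \<longleftrightarrow> g \<in> carrier G \<and> (\<forall>k::nat. k > 0 \<longrightarrow> g [^]\<^bsub>G\<^esub> k \<noteq> \<one>\<^bsub>G\<^esub>)"


section \<open>The Legendre curve and the points in question\<close>

(* x (x + 1) (x + lam) = x^3 + (1 + lam) x^2 + lam x *)
definition legendre :: "'a::field \<Rightarrow> 'a weierstrass" where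
  "legendre lam = Weierstrass 0 (1 + lam) 0 lam 0"

(* rt u is the chosen square root of (u^(n-1) + 1) / (u + 1). *)
definition legendre_point :: "('a::field \<Rightarrow> 'a) \<Rightarrow> 'a \<Rightarrow> 'a point" where
  "legendre_point rt u = Affine u (u * (u + 1) * rt u)"

definition root_field :: "'a::field_char_0 set \<Rightarrow> ('a \<Rightarrow> 'a) \<Rightarrow> 'a \<Rightarrow> 'a set" where
  "root_field K rt u = generate_field Kbar (K \<union> {u, rt u})"

end

theory Submission
  imports Defs
begin

text \<open>
  For the associativity of the group law, the coordinate ring of \<open>y\<^sup>2 = f(x)\<close> is embedded into the
  Laurent series field at infinity (\<open>x = t\<close> to the power \<open>-2\<close>). A point \<open>P\<close> is sent to the class of its ideal
  \<open>I(P)\<close>; the line through three points shows that \<open>I(P) I(Q)\<close> and \<open>I(P + Q)\<close> have the same class,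
  and since no regular function has a pole of order exactly 1, distinct points have distinct classes.

  If the chosen square root \<open>r\<close> lies in a prime \<open>p\<close>, then \<open>P\<close> reduces to a 2-torsion point and \<open>2 P\<close>
  lies in the kernel of reduction. There \<open>z = x / y\<close> satisfies \<open>z(k Q) = (k + \<mu>) z(Q)\<close> with \<open>\<mu>\<close>
  in the maximal ideal, so the kernel has no torsion of order prime to \<open>p\<close>. Two residue characteristics
  together exclude all torsion, hence \<open>2 P = 0\<close>, that is \<open>r = 0\<close>; this is impossible because at the
  root \<open>-u\<close> it would put 2 into a prime not over 2.

  \<open>K'\<close> is generated by all \<open>u\<close> and \<open>r(u)\<close>. Every element of \<open>K'\<close> lies in a list of elements of \<open>K'\<close>
  all of whose power sums are in \<open>K\<close>, a property stable under ring operations; by Newton's identities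
  \<open>K'\<close> is normal. The successive commutator subgroups of the Galois group fix the \<open>n\<close>-th roots of
  unity, the roots \<open>u\<close>, and the square roots \<open>r(u)\<close>.
\<close>

section \<open>Pole orders at infinity\<close>

text \<open>Verified in coordinates, associativity would split into many degenerate cases:
  doublings, opposite points, coincidences between partial sums. Products of ideals are associative
  and commutative for free, so with classes the geometry enters only through one line or one
  vertical at a time. Classes are formed by scaling with elements of a field; Laurent series in t,
  where x has order -2 and y has order -3, supply both such a field and the pole orders that detect
  nonprincipal ideals.

  The double of P is taken because r appears only in the y-coordinate of P, as a factor of the
  numerator, but in the denominators of both coordinates of 2 P. The two primes act through one
  consequence: every rational prime is invertible in at least one of the two local rings, so the
  order can be stripped of one prime factor at a time.

  The square roots are chosen independently for each u, so the chosen values need not be stable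
  under automorphisms; in the Galois part they are completed by their negatives.\<close>

definition at_inf :: "'a::field_char_0 poly \<Rightarrow> 'a fls" where
  "at_inf p = poly (map_poly fls_const p) (fls_X_inv\<^sup>2)"

lemma at_inf_0 [simp]: "at_inf 0 = 0"
  by (simp add: at_inf_def)

lemma at_inf_pCons [simp]: "at_inf (pCons k p) = fls_const k + fls_X_inv\<^sup>2 * at_inf p"
  by (cases "p = 0 \<and> k = 0") (auto simp: at_inf_def map_poly_pCons)

lemma at_inf_add [simp]: "at_inf (p + q) = at_inf p + at_inf q"
proof (induction p q rule: poly_induct2)
  case (pCons k p l q)
  then show ?case
    by (simp add: algebra_simps flip: fls_plus_const)
qed simp

lemma at_inf_smult [simp]: "at_inf (smult k p) = fls_const k * at_inf p"
  by (induction p) (simp_all add: algebra_simps)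

lemma at_inf_mult [simp]: "at_inf (p * q) = at_inf p * at_inf q"
  by (induction p) (simp_all add: algebra_simps)

lemma at_inf_minus [simp]: "at_inf (- p) = - at_inf p"
  using at_inf_smult[of "-1" p] by simp

lemma at_inf_diff [simp]: "at_inf (p - q) = at_inf p - at_inf q"
  using at_inf_add[of p "- q"] by simp

lemma at_inf_1 [simp]: "at_inf 1 = 1"
  by (simp add: one_pCons)

lemma at_inf_power [simp]: "at_inf (p ^ n) = at_inf p ^ n"
  by (induction n) simp_all

text \<open>No cancellation is possible: the constant term has order 0, while the rest carries the
  factor t^-2 and has order at most -2.\<close>

lemma at_inf_subdegree:
  assumes "p \<noteq> 0"
  shows "at_inf p \<noteq> 0 \<and> fls_subdegree (at_inf p) = - 2 * int (degree p)"
  using assms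
proof (induction p)
  case (pCons k p)
  show ?case
  proof (cases "p = 0")
    case True
    with pCons show ?thesis by simp
  next
    case False
    have X: "fls_X_inv\<^sup>2 * at_inf p \<noteq> 0" "fls_subdegree (fls_X_inv\<^sup>2 * at_inf p) = - 2 * int (degree p) - 2"
      using pCons.IH[OF False] by (simp_all add: fls_subdegree_mult)
    have "fls_subdegree (at_inf (pCons k p)) = - 2 * int (degree p) - 2"
    proof (cases "k = 0")
      case False
      then show ?thesis
        using fls_subdegree_add_eq2[of "fls_X_inv\<^sup>2 * at_inf p" "fls_const k"] X by simp
    qed (use X in simp)
    moreover from this have "at_inf (pCons k p) \<noteq> 0"
      by force
    ultimately show ?thesis
      using False by simp
  qed
qed simp

lemma at_inf_eq_0_iff [simp]: "at_inf p = 0 \<longleftrightarrow> p = 0"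
  using at_inf_subdegree[of p] by auto

text \<open>With f the cubic, f(t^-2) = t^-6 g(t) where g has constant term 1. So g has a power
  series square root, and t^-6 is the square of t^-3.\<close>

lemma sqrt_at_inf_ex:
  fixes a b c :: "'a::field_char_0"
  obtains Y where "Y\<^sup>2 = at_inf [:c, b, a, 1:]"
proof -
  define g :: "'a fps" where
    "g = 1 + fps_const a * fps_X\<^sup>2 + fps_const b * fps_X ^ 4 + fps_const c * fps_X ^ 6"
  \<comment> \<open>The first argument of \<open>fps_radical\<close> chooses a root of the constant
    coefficient; as that coefficient is 1, the constant choice 1 serves.\<close>
  define s where "s = fps_radical (\<lambda>_ _. 1) 2 g"
  have "s\<^sup>2 = g"
    using power_radical[of g "\<lambda>_ _. 1" 1] by (simp add: g_def s_def numeral_2_eq_2)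
  hence s: "(fps_to_fls s)\<^sup>2 = fps_to_fls g"
    by (simp add: power2_eq_square flip: fls_times_fps_to_fls)
  have inv: "fls_X_inv * fls_X = (1 :: 'a fls)"
    by (metis fls_inverse_X_inv fls_X_inv_nonzero right_inverse)
  have "fps_to_fls g = 1 + fls_const a * fls_X\<^sup>2 + fls_const b * fls_X ^ 4 + fls_const c * fls_X ^ 6"
    by (simp add: g_def fls_times_fps_to_fls fps_to_fls_power)
  hence "(fls_X_inv ^ 3 * fps_to_fls s)\<^sup>2 =
      fls_X_inv ^ 6 * (1 + fls_const a * fls_X\<^sup>2 + fls_const b * fls_X ^ 4 + fls_const c * fls_X ^ 6)"
    by (simp add: power_mult_distrib s flip: power_mult)
  also have "\<dots> = at_inf [:c, b, a, 1:]"
  proof -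
    have "fls_X_inv ^ 6 * fls_X ^ k = (fls_X_inv ^ (6 - k) :: 'a fls)" if "k \<le> 6" for k
    proof -
      have "fls_X_inv ^ 6 * fls_X ^ k = fls_X_inv ^ (6 - k) * (fls_X_inv * fls_X :: 'a fls) ^ k"
        using that by (simp add: power_mult_distrib flip: power_add mult.assoc)
      thus ?thesis by (simp add: inv)
    qed
    from this[of 2] this[of 4] this[of 6]
    have "fls_X_inv ^ 6 * fls_X ^ 2 = (fls_X_inv ^ 4 :: 'a fls)"
      "fls_X_inv ^ 6 * fls_X ^ 4 = (fls_X_inv ^ 2 :: 'a fls)"
      "fls_X_inv ^ 6 * fls_X ^ 6 = (1 :: 'a fls)" by simp_all
    thus ?thesis
      by (simp add: distrib_left mult.left_commute)
  qed
  finally show ?thesis by (rule that)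
qed

text \<open>Substituting the line into the curve leaves a monic cubic with roots x1, x2, x3, and the
  last three conclusions are its Vieta relations. In this form secant and tangent need no longer be
  told apart, neither for ideals nor for the formal group.\<close>

lemma point_add_chord:
  fixes a b c :: "'a::field_char_0"
  defines "W \<equiv> Weierstrass 0 a 0 b c"
  assumes P1: "on_curve W (Affine x1 y1)" and P2: "on_curve W (Affine x2 y2)"
    and "\<not> (x1 = x2 \<and> y1 + y2 = 0)"
  obtains l m x3 where "y1 = l * x1 + m" "y2 = l * x2 + m"
    "point_add W (Affine x1 y1) (Affine x2 y2) = Affine x3 (- (l * x3 + m))"
    "x1 + x2 + x3 = l\<^sup>2 - a" "x1 * x2 + x1 * x3 + x2 * x3 = b - 2 * l * m"
    "x1 * x2 * x3 = m\<^sup>2 - c"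
proof -
  have e1: "y1\<^sup>2 = x1 ^ 3 + a * x1\<^sup>2 + b * x1 + c" and e2: "y2\<^sup>2 = x2 ^ 3 + a * x2\<^sup>2 + b * x2 + c"
    using P1 P2 by (simp_all add: W_def)
  define l where "l = (if x1 \<noteq> x2 then (y2 - y1) / (x2 - x1) else (3 * x1\<^sup>2 + 2 * a * x1 + b) / (2 * y1))"
  define m where "m = y1 - l * x1"
  define x3 where "x3 = l\<^sup>2 - a - x1 - x2"
  have add: "point_add W (Affine x1 y1) (Affine x2 y2) = Affine x3 (- (l * x3 + m))"
    using assms(4) by (simp add: W_def l_def m_def x3_def Let_def)
  have line1: "y1 = l * x1 + m"
    by (simp add: m_def)
  have "y2 = l * x2 + m \<and> x1 * x2 + x1 * x3 + x2 * x3 = b - 2 * l * m"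
  proof (cases "x1 = x2")
    case False
    hence "l * (x2 - x1) = y2 - y1"
      by (simp add: l_def)
    hence line2: "y2 = l * x2 + m"
      by (simp add: m_def algebra_simps)
    \<comment> \<open>The difference of the two curve equations is divisible by x1 - x2, and the
      quotient is the second Vieta relation.\<close>
    have "(x1 - x2) * (x1 * x2 + x1 * x3 + x2 * x3 - (b - 2 * l * m)) = 0"
    proof -
      have "(x1 - x2) * (x1 * x2 + x1 * x3 + x2 * x3 - (b - 2 * l * m)) =
          ((l * x1 + m)\<^sup>2 - (x1 ^ 3 + a * x1\<^sup>2 + b * x1 + c))
          - ((l * x2 + m)\<^sup>2 - (x2 ^ 3 + a * x2\<^sup>2 + b * x2 + c))"
        unfolding x3_def by (simp add: power2_eq_square power3_eq_cube algebra_simps)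
      also have "\<dots> = 0"
        using e1 e2 by (simp flip: line1 line2)
      finally show ?thesis .
    qed
    with False line2 show ?thesis by simp
  next
    case True
    have "y1 = y2"
      using e1 e2 True assms(4) by (metis power2_eq_iff add.left_inverse add.commute)
    moreover from this True assms(4) have "y1 \<noteq> 0" by auto
    ultimately have "2 * y1 * l = 3 * x1\<^sup>2 + 2 * a * x1 + b"
      using True by (simp add: l_def)
    moreover have "x1 * x2 + x1 * x3 + x2 * x3 - (b - 2 * l * m) = 2 * y1 * l - (3 * x1\<^sup>2 + 2 * a * x1 + b)"
      unfolding x3_def m_def True by (simp add: power2_eq_square algebra_simps)
    ultimately have "x1 * x2 + x1 * x3 + x2 * x3 = b - 2 * l * m"
      by simp
    thus ?thesis
      using True line1 \<open>y1 = y2\<close> by simp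
  qed
  moreover from this have "x1 * x2 * x3 = m\<^sup>2 - c"
  proof -
    \<comment> \<open>The cubic vanishes at x1, so its constant coefficient is determined by the
      other two.\<close>
    have "x1 * x2 * x3 - (m\<^sup>2 - c) = x1 * (x1 * x2 + x1 * x3 + x2 * x3 - (b - 2 * l * m))
        + x1 ^ 3 + a * x1\<^sup>2 + b * x1 + c - (l * x1 + m)\<^sup>2"
      unfolding x3_def by (simp add: power2_eq_square power3_eq_cube algebra_simps)
    thus ?thesis
      using e1 calculation by (simp flip: line1)
  qed
  ultimately show ?thesis
    using that[OF line1 _ add] by (simp add: x3_def)
qed

section \<open>Products of ideals, and classes up to scaling\<close>

inductive_set ideal_prod :: "'r::comm_ring_1 set \<Rightarrow> 'r set \<Rightarrow> 'r set" for I J where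
  zero: "0 \<in> ideal_prod I J"
| step: "x \<in> I \<Longrightarrow> y \<in> J \<Longrightarrow> z \<in> ideal_prod I J \<Longrightarrow> x * y + z \<in> ideal_prod I J"

lemma ideal_prod_mult: "x \<in> I \<Longrightarrow> y \<in> J \<Longrightarrow> x * y \<in> ideal_prod I J"
  using ideal_prod.step[OF _ _ ideal_prod.zero] by force

lemma ideal_prod_add: "x \<in> ideal_prod I J \<Longrightarrow> y \<in> ideal_prod I J \<Longrightarrow> x + y \<in> ideal_prod I J"
  by (induction rule: ideal_prod.induct) (auto simp: add.assoc intro: ideal_prod.step)

lemma ideal_prod_subset:
  assumes "\<And>x y. x \<in> I \<Longrightarrow> y \<in> J \<Longrightarrow> x * y \<in> M" "0 \<in> M" "\<And>x y. x \<in> M \<Longrightarrow> y \<in> M \<Longrightarrow> x + y \<in> M"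
  shows "ideal_prod I J \<subseteq> M"
proof
  fix z assume "z \<in> ideal_prod I J"
  thus "z \<in> M" by induction (auto intro: assms)
qed

lemma ideal_prod_commute: "ideal_prod I J = ideal_prod J I"
proof -
  have "ideal_prod I J \<subseteq> ideal_prod J I" for I J :: "'r::comm_ring_1 set"
    by (rule ideal_prod_subset)
      (auto intro: ideal_prod_add ideal_prod.zero, metis ideal_prod_mult mult.commute)
  thus ?thesis by blast
qed

lemma ideal_prod_assoc: "ideal_prod (ideal_prod I J) K = ideal_prod I (ideal_prod J K)"
proof -
  have sub: "ideal_prod (ideal_prod I J) K \<subseteq> ideal_prod I (ideal_prod J K)" for I J K :: "'r::comm_ring_1 set"
  proof (rule ideal_prod_subset)
    fix x k assume "x \<in> ideal_prod I J" and k: "k \<in> K"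
    thus "x * k \<in> ideal_prod I (ideal_prod J K)"
    proof induction
      case (step x y z)
      thus ?case
        using ideal_prod.step[OF step(1) ideal_prod_mult[OF step(2) k]]
        by (simp add: algebra_simps)
    qed (simp add: ideal_prod.zero)
  qed (auto intro: ideal_prod_add ideal_prod.zero)
  show ?thesis
    using sub[of I J K] sub[of K J I]
    by (metis ideal_prod_commute subset_antisym)
qed

lemma ideal_prod_image: "ideal_prod ((*) g ` I) J = (*) g ` ideal_prod I J"
proof
  show "ideal_prod ((*) g ` I) J \<subseteq> (*) g ` ideal_prod I J"
  proof (rule ideal_prod_subset)
    fix x y assume "x \<in> (*) g ` I" "y \<in> J"
    thus "x * y \<in> (*) g ` ideal_prod I J"
      by (auto simp: mult.assoc intro: ideal_prod_mult)
  next
    show "0 \<in> (*) g ` ideal_prod I J"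
      by (rule image_eqI[of _ _ 0]) (auto intro: ideal_prod.zero)
  next
    fix x y assume "x \<in> (*) g ` ideal_prod I J" "y \<in> (*) g ` ideal_prod I J"
    thus "x + y \<in> (*) g ` ideal_prod I J"
      by (auto simp: ideal_prod_add simp flip: distrib_left)
  qed
next
  have "g * z \<in> ideal_prod ((*) g ` I) J" if "z \<in> ideal_prod I J" for z
    using that
  proof induction
    case (step x y z)
    thus ?case
      using ideal_prod.step[of "g * x" "(*) g ` I" y J "g * z"] by (simp add: algebra_simps)
  qed (simp add: ideal_prod.zero)
  thus "(*) g ` ideal_prod I J \<subseteq> ideal_prod ((*) g ` I) J"
    by blast
qed

text \<open>Two scalars instead of one quotient keep the relation symmetric and free of inverses.
  For nonzero ideals of a domain inside the field this is equality of ideal classes.\<close>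

definition same_class :: "'f::field set \<Rightarrow> 'f set \<Rightarrow> bool" where
  "same_class I J \<longleftrightarrow> (\<exists>g h. g \<noteq> 0 \<and> h \<noteq> 0 \<and> (*) g ` I = (*) h ` J)"

lemma same_class_refl: "same_class I I"
  unfolding same_class_def by (intro exI[of _ 1]) simp

lemma same_class_sym: "same_class I J \<Longrightarrow> same_class J I"
  unfolding same_class_def by metis

lemma same_class_trans:
  assumes "same_class I J" "same_class J K"
  shows "same_class I K"
proof -
  obtain g h where 1: "g \<noteq> 0" "h \<noteq> 0" "(*) g ` I = (*) h ` J"
    using assms(1) unfolding same_class_def by auto
  obtain g' h' where 2: "g' \<noteq> 0" "h' \<noteq> 0" "(*) g' ` J = (*) h' ` K"
    using assms(2) unfolding same_class_def by auto
  have "(*) (g' * g) ` I = (*) g' ` (*) g ` I"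
    by (simp add: image_image mult.assoc)
  also have "\<dots> = (*) h ` (*) g' ` J"
    unfolding 1(3) by (simp add: image_image mult.left_commute)
  also have "\<dots> = (*) (h * h') ` K"
    unfolding 2(3) by (simp add: image_image mult.assoc)
  finally have "(*) (g' * g) ` I = (*) (h * h') ` K" .
  moreover have "g' * g \<noteq> 0" "h * h' \<noteq> 0"
    using 1 2 by simp_all
  ultimately show ?thesis
    unfolding same_class_def by blast
qed

lemma same_class_prod: "same_class I J \<Longrightarrow> same_class (ideal_prod I K) (ideal_prod J K)"
  unfolding same_class_def by (metis ideal_prod_image)

lemma same_class_image: "g \<noteq> 0 \<Longrightarrow> same_class ((*) g ` I) I"
  unfolding same_class_def by (rule exI[of _ 1], rule exI[of _ g]) simp

section \<open>Ideals of the coordinate ring\<close>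

text \<open>As t is invertible modulo X - x, some combination of t and X - x is a nonzero constant;
  multiplied by s it lies in M. This cancels linear factors one at a time.\<close>

lemma poly_ideal_descend:
  fixes M :: "'a::field poly set"
  assumes add: "\<And>p q. p \<in> M \<Longrightarrow> q \<in> M \<Longrightarrow> p + q \<in> M"
    and mult: "\<And>p q. p \<in> M \<Longrightarrow> q * p \<in> M"
    and "[:- x, 1:] * s \<in> M" and t: "t \<in> M" "poly t x \<noteq> 0"
  shows "s \<in> M"
proof -
  have "poly (t - [:poly t x:]) x = 0"
    by simp
  then obtain t' where t': "t - [:poly t x:] = [:- x, 1:] * t'"
    by (metis dvdE poly_eq_0_iff_dvd)
  have "smult (poly t x) s = s * [:poly t x:]"
    by simp
  also have "[:poly t x:] = t - [:- x, 1:] * t'"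
    using t' by (simp add: algebra_simps)
  also have "s * (t - [:- x, 1:] * t') = s * t + (- t') * ([:- x, 1:] * s)"
    by (simp add: right_diff_distrib mult_ac)
  finally have "[:inverse (poly t x):] * smult (poly t x) s \<in> M"
    using assms by (metis add mult)
  thus ?thesis
    using t by simp
qed

text \<open>The condition \<open>smooth\<close> says that the cubic has no multiple root. It is used
  at points with y = 0, where only a nonzero derivative makes the ideal of the point
  invertible.\<close>

locale coord_ring =
  fixes a b c :: "'a::field_char_0" and Y :: "'a fls"
  assumes Y_sq: "Y\<^sup>2 = at_inf [:c, b, a, 1:]"
    and smooth: "x ^ 3 + a * x\<^sup>2 + b * x + c = 0 \<Longrightarrow> 3 * x\<^sup>2 + 2 * a * x + b \<noteq> 0"
begin

definition elem :: "'a poly \<Rightarrow> 'a poly \<Rightarrow> 'a fls" where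
  "elem p q = at_inf p + at_inf q * Y"

definition R :: "'a fls set" where
  "R = {elem p q | p q. True}"

lemma elem_in_R [intro]: "elem p q \<in> R"
  by (auto simp: R_def)

lemma elem_0 [simp]: "elem 0 0 = 0"
  by (simp add: elem_def)

lemma elem_add: "elem p q + elem p' q' = elem (p + p') (q + q')"
  by (simp add: elem_def algebra_simps)

lemma elem_mult:
  "elem p q * elem p' q' = elem (p * p' + q * q' * [:c, b, a, 1:]) (p * q' + q * p')"
proof -
  have "elem p q * elem p' q' = at_inf p * at_inf p' + at_inf q * at_inf q' * Y\<^sup>2
      + (at_inf p * at_inf q' + at_inf q * at_inf p') * Y"
    by (simp add: elem_def power2_eq_square algebra_simps)
  thus ?thesis
    by (simp only: Y_sq elem_def at_inf_add at_inf_mult)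
qed

lemma R_add: "x \<in> R \<Longrightarrow> y \<in> R \<Longrightarrow> x + y \<in> R"
  by (auto simp: R_def elem_add) blast

lemma R_mult: "x \<in> R \<Longrightarrow> y \<in> R \<Longrightarrow> x * y \<in> R"
  by (auto simp: R_def elem_mult) blast

lemma at_inf_in_R: "at_inf p \<in> R" and Y_in_R: "Y \<in> R"
  using elem_in_R[of p 0] elem_in_R[of 0 1] by (simp_all add: elem_def)

lemma one_in_R: "1 \<in> R"
  using at_inf_in_R[of 1] by simp

lemma R_minus: "x \<in> R \<Longrightarrow> - x \<in> R"
  using R_mult[OF at_inf_in_R[of "-1"]] by simp

lemma R_diff: "x \<in> R \<Longrightarrow> y \<in> R \<Longrightarrow> x - y \<in> R"
  using R_add[OF _ R_minus] by force

lemmas R_intros = R_add R_mult R_minus R_diff at_inf_in_R Y_in_R one_in_R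

lemma Y_subdegree: "Y \<noteq> 0" "fls_subdegree Y = - 3"
proof -
  have *: "Y\<^sup>2 \<noteq> 0" "fls_subdegree (Y\<^sup>2) = - 6"
    using at_inf_subdegree[of "[:c, b, a, 1:]"] by (simp_all add: Y_sq del: at_inf_pCons)
  show "Y \<noteq> 0"
    using * by auto
  thus "fls_subdegree Y = - 3"
    using * by (simp add: power2_eq_square)
qed

text \<open>The part p(x) has even order and the part q(x) y odd order, so the two never cancel. The
  case split is forced by the convention that the zero polynomial has degree 0.\<close>

lemma elem_subdegree:
  assumes "p \<noteq> 0 \<or> q \<noteq> 0"
  shows "elem p q \<noteq> 0 \<and> fls_subdegree (elem p q) =
    - int (if q = 0 then 2 * Polynomial.degree p else if p = 0 then 2 * Polynomial.degree q + 3
        else max (2 * Polynomial.degree p) (2 * Polynomial.degree q + 3))"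
proof (cases "p = 0 \<or> q = 0")
  case True
  thus ?thesis
    using assms at_inf_subdegree[of p] at_inf_subdegree[of q] Y_subdegree by (auto simp: elem_def)
next
  case False
  let ?u = "at_inf p" and ?v = "at_inf q * Y"
  have u: "?u \<noteq> 0" "fls_subdegree ?u = - int (2 * Polynomial.degree p)"
    and v: "?v \<noteq> 0" "fls_subdegree ?v = - int (2 * Polynomial.degree q + 3)"
    using at_inf_subdegree[of p] at_inf_subdegree[of q] Y_subdegree False by auto
  have "fls_subdegree ?u \<noteq> fls_subdegree ?v"
    unfolding u v by presburger
  hence "fls_subdegree (?u + ?v) = min (fls_subdegree ?u) (fls_subdegree ?v)"
    using u(1) v(1) fls_subdegree_add_eq1[of ?u ?v] fls_subdegree_add_eq2[of ?v ?u]
    by (cases "fls_subdegree ?u < fls_subdegree ?v") auto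
  hence "fls_subdegree (elem p q) = - int (max (2 * Polynomial.degree p) (2 * Polynomial.degree q + 3))"
    unfolding elem_def u v by simp
  moreover from this have "elem p q \<noteq> 0"
    by force
  ultimately show ?thesis
    using False by simp
qed

lemma elem_eq_0_iff: "elem p q = 0 \<longleftrightarrow> p = 0 \<and> q = 0"
  using elem_subdegree[of p q] by auto

lemma elem_eq_iff: "elem p q = elem p' q' \<longleftrightarrow> p = p' \<and> q = q'"
  using elem_eq_0_iff[of "p - p'" "q - q'"] by (auto simp: elem_def algebra_simps)

text \<open>The available pole orders are 2 i and 2 j + 3, so 1 is the only gap. This is where genus
  1 enters.\<close>

lemma R_subdegree:
  assumes "x \<in> R" "x \<noteq> 0"
  shows "fls_subdegree x \<le> 0" "fls_subdegree x \<noteq> - 1"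
    "fls_subdegree x = 0 \<Longrightarrow> \<exists>k. x = fls_const k"
proof -
  obtain p q where x: "x = elem p q"
    using assms(1) by (auto simp: R_def)
  have pq: "p \<noteq> 0 \<or> q \<noteq> 0"
    using assms(2) x by auto
  show "fls_subdegree x \<le> 0" "fls_subdegree x \<noteq> - 1"
    using elem_subdegree[OF pq] unfolding x by (auto split: if_splits) presburger?
  show "\<exists>k. x = fls_const k" if "fls_subdegree x = 0"
  proof -
    have "q = 0" "Polynomial.degree p = 0"
      using elem_subdegree[OF pq] that pq unfolding x by (auto split: if_splits)
    thus ?thesis
      by (elim degree_eq_zeroE) (auto simp: x elem_def)
  qed
qed

text \<open>The elements of \<open>R\<close> are regular away from infinity, so infinity imposes no
  vanishing condition and receives the trivial class.\<close>

fun point_ideal :: "'a point \<Rightarrow> 'a fls set" where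
  "point_ideal Infinity = R"
| "point_ideal (Affine x y) = {elem p q | p q. poly p x + poly q x * y = 0}"

definition submodule :: "'a fls set \<Rightarrow> bool" where
  "submodule M \<longleftrightarrow> 0 \<in> M \<and> (\<forall>x\<in>M. \<forall>y\<in>M. x + y \<in> M) \<and> (\<forall>r\<in>R. \<forall>x\<in>M. r * x \<in> M)"

abbreviation "W \<equiv> Weierstrass 0 a 0 b c"

lemma submodule_point_ideal:
  assumes "on_curve W P"
  shows "submodule (point_ideal P)"
proof (cases P)
  case (Affine x y)
  have y: "y * y = c + x * (b + x * (a + x))"
    using assms by (simp add: Affine power2_eq_square power3_eq_cube algebra_simps)
  have mult: "r * z \<in> point_ideal P" if r: "r \<in> R" and z: "z \<in> point_ideal P" for r z
  proof -
    obtain p q where pq: "r = elem p q"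
      using r by (auto simp: R_def)
    obtain p' q' where pq': "z = elem p' q'" "poly p' x + poly q' x * y = 0"
      using z by (auto simp: Affine)
    have "poly (p * p' + q * q' * [:c, b, a, 1:]) x + poly (p * q' + q * p') x * y
        = (poly p x + poly q x * y) * (poly p' x + poly q' x * y)
          + poly q x * poly q' x * ((c + x * (b + x * (a + x))) - y * y)"
      by (simp add: algebra_simps)
    also have "\<dots> = 0"
      unfolding y pq'(2) by simp
    finally show ?thesis
      unfolding pq pq' elem_mult Affine point_ideal.simps by blast
  qed
  moreover have "0 \<in> point_ideal P"
    unfolding Affine point_ideal.simps by (intro CollectI exI[of _ 0]) simp
  moreover have "z + z' \<in> point_ideal P" if "z \<in> point_ideal P" "z' \<in> point_ideal P" for z z'
  proof -
    obtain p q p' q' where "z = elem p q" "poly p x + poly q x * y = 0"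
      "z' = elem p' q'" "poly p' x + poly q' x * y = 0"
      using \<open>z \<in> _\<close> \<open>z' \<in> _\<close> by (auto simp: Affine)
    moreover from this have "poly (p + p') x + poly (q + q') x * y = 0"
      by (simp add: algebra_simps)
    moreover from calculation have "z + z' = elem (p + p') (q + q')"
      by (simp add: elem_add)
    ultimately show ?thesis
      unfolding Affine point_ideal.simps by blast
  qed
  ultimately show ?thesis
    by (simp add: submodule_def)
qed (use R_add R_mult elem_in_R[of 0 0] in \<open>auto simp: submodule_def\<close>)

lemma submodule_ideal_prod:
  assumes "submodule I"
  shows "submodule (ideal_prod I J)"
proof -
  have "r * z \<in> ideal_prod I J" if "r \<in> R" "z \<in> ideal_prod I J" for r z
    using that(2)
  proof induction
    case (step x y z)
    have "r * x \<in> I"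
      using step that assms by (auto simp: submodule_def)
    from ideal_prod.step[OF this step(2,4)] show ?case
      by (simp add: algebra_simps)
  qed (simp add: ideal_prod.zero)
  thus ?thesis
    by (auto simp: submodule_def ideal_prod.zero ideal_prod_add)
qed

lemma ideal_prod_R:
  assumes "submodule M"
  shows "ideal_prod R M = M"
proof
  show "ideal_prod R M \<subseteq> M"
    using assms by (intro ideal_prod_subset) (auto simp: submodule_def)
  show "M \<subseteq> ideal_prod R M"
    using ideal_prod_mult[OF one_in_R] by fastforce
qed

declare point_ideal.simps [simp del]

text \<open>Modulo Y - L, with L the line l x + m, a function becomes a polynomial in x alone, and
  vanishing at the point becomes divisibility by X - x. Hence X - x and any nonvertical line through
  the point generate its ideal.\<close>

lemma point_ideal_line:
  assumes "z \<in> point_ideal (Affine x (l * x + m))"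
  obtains r s where "r \<in> R" "s \<in> R" "z = at_inf [:- x, 1:] * r + (Y - at_inf [:m, l:]) * s"
proof -
  obtain p q where z: "z = elem p q" and root: "poly p x + poly q x * (l * x + m) = 0"
    using assms by (auto simp: point_ideal.simps)
  have "poly (p + q * [:m, l:]) x = 0"
    using root by (simp add: algebra_simps)
  then obtain r where r: "p + q * [:m, l:] = [:- x, 1:] * r"
    by (metis dvdE poly_eq_0_iff_dvd)
  have "z = at_inf (p + q * [:m, l:]) + (Y - at_inf [:m, l:]) * at_inf q"
    unfolding z elem_def at_inf_add at_inf_mult by (simp only: algebra_simps)
  also have "\<dots> = at_inf [:- x, 1:] * at_inf r + (Y - at_inf [:m, l:]) * at_inf q"
    unfolding r at_inf_mult ..
  finally show ?thesis
    using that at_inf_in_R by blast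
qed

lemma vertical_in_point_ideal: "at_inf [:- x, 1:] \<in> point_ideal (Affine x y)"
  by (simp add: point_ideal.simps del: at_inf_pCons) (rule exI[of _ "[:- x, 1:]"], rule exI[of _ 0], simp add: elem_def)

lemma line_in_point_ideal: "Y - at_inf [:m, l:] \<in> point_ideal (Affine x (l * x + m))"
proof -
  have "Y - at_inf [:m, l:] = elem (- [:m, l:]) 1"
    by (simp only: elem_def at_inf_minus at_inf_1) simp
  moreover have "poly (- [:m, l:]) x + poly 1 x * (l * x + m) = 0"
    by simp
  ultimately show ?thesis
    unfolding point_ideal.simps by blast
qed

text \<open>(Y - L) (Y + L) = f - L^2 is the product of the three verticals \<open>A1\<close>,
  \<open>A2\<close>, \<open>A3\<close>. Expanding a product of three generators, each term contains
  either Y - L or all three verticals; this is one inclusion.\<close>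

lemma ideal_prod_line:
  assumes fac: "[:c, b, a, 1:] - [:m, l:]\<^sup>2 = [:- x1, 1:] * [:- x2, 1:] * [:- x3, 1:]"
  shows "ideal_prod (ideal_prod (point_ideal (Affine x1 (l * x1 + m))) (point_ideal (Affine x2 (l * x2 + m))))
      (point_ideal (Affine x3 (l * x3 + m))) = (*) (Y - at_inf [:m, l:]) ` R" (is "?T = _")
proof -
  define L where "L = at_inf [:m, l:]"
  define A1 A2 A3 where A: "A1 = at_inf [:- x1, 1:]" "A2 = at_inf [:- x2, 1:]" "A3 = at_inf [:- x3, 1:]"
  let ?J = "\<lambda>x. point_ideal (Affine x (l * x + m))"
  have AR: "A1 \<in> R" "A2 \<in> R" "A3 \<in> R" "L \<in> R" "Y - L \<in> R" "Y + L \<in> R"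
    unfolding A L_def by (intro R_intros)+
  have prod: "A1 * A2 * A3 = (Y - L) * (Y + L)"
  proof -
    have "A1 * A2 * A3 = at_inf ([:c, b, a, 1:] - [:m, l:]\<^sup>2)"
      unfolding A fac at_inf_mult ..
    also have "\<dots> = Y\<^sup>2 - L\<^sup>2"
      by (simp only: Y_sq L_def at_inf_diff at_inf_power)
    finally show ?thesis
      by (simp add: power2_eq_square algebra_simps)
  qed
  have on_curve: "on_curve W (Affine x (l * x + m))" if "x \<in> {x1, x2, x3}" for x
  proof -
    have "poly ([:c, b, a, 1:] - [:m, l:]\<^sup>2) x = 0"
      unfolding fac poly_mult using that by auto
    thus ?thesis
      by (simp add: power2_eq_square power3_eq_cube algebra_simps)
  qed
  have sub: "submodule (ideal_prod (?J x1) (?J x2))" "submodule ?T"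
    by (intro submodule_ideal_prod submodule_point_ideal on_curve; simp)+
  have T_add: "z + z' \<in> ?T" if "z \<in> ?T" "z' \<in> ?T" for z z'
    using sub(2) that unfolding submodule_def by blast
  have T_mult: "r * z \<in> ?T" if "z \<in> ?T" "r \<in> R" for r z
    using sub(2) that unfolding submodule_def by blast
  have gen: "A1 \<in> ?J x1" "A2 \<in> ?J x2" "A3 \<in> ?J x3" "Y - L \<in> ?J x" for x
    unfolding A L_def by (rule vertical_in_point_ideal line_in_point_ideal)+
  have "?T \<subseteq> (*) (Y - L) ` R"
  proof (rule ideal_prod_subset)
    have add: "u + v \<in> (*) (Y - L) ` R" if "u \<in> (*) (Y - L) ` R" "v \<in> (*) (Y - L) ` R" for u v
      using that R_add by (auto simp flip: distrib_left)
    show "u + v \<in> (*) (Y - L) ` R" if "u \<in> (*) (Y - L) ` R" "v \<in> (*) (Y - L) ` R" for u v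
      by (rule add[OF that])
    show zero: "0 \<in> (*) (Y - L) ` R"
      by (rule image_eqI[of _ _ 0]) (use at_inf_in_R[of 0] in simp_all)
    fix w z assume w: "w \<in> ideal_prod (?J x1) (?J x2)" and "z \<in> ?J x3"
    then obtain r s where z: "r \<in> R" "s \<in> R" "z = A3 * r + (Y - L) * s"
      unfolding A L_def by (elim point_ideal_line)
    from w show "w * z \<in> (*) (Y - L) ` R"
    proof induction
      case (step u v w)
      obtain r1 s1 where u: "r1 \<in> R" "s1 \<in> R" "u = A1 * r1 + (Y - L) * s1"
        using step(1) unfolding A L_def by (elim point_ideal_line)
      obtain r2 s2 where v: "r2 \<in> R" "s2 \<in> R" "v = A2 * r2 + (Y - L) * s2"
        using step(2) unfolding A L_def by (elim point_ideal_line)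
      define t where "t = r1 * r2 * r * (Y + L) + s * A1 * A2 * r1 * r2 
        + (A1 * r1 * s2 + A2 * r2 * s1 + (Y - L) * s1 * s2) * z"
      have "z \<in> R"
        unfolding z(3) by (intro R_intros AR z)
      hence "t \<in> R"
        unfolding t_def by (intro R_add R_mult AR u v z)
      have "u * v * z = (A1 * A2 * r1 * r2 + (Y - L) * (A1 * r1 * s2 + A2 * r2 * s1 + (Y - L) * s1 * s2)) * z"
        unfolding u v by (simp add: algebra_simps)
      also have "\<dots> = (A1 * A2 * A3) * (r1 * r2 * r) + (Y - L) * (s * A1 * A2 * r1 * r2 + (A1 * r1 * s2 + A2 * r2 * s1 + (Y - L) * s1 * s2) * z)"
        unfolding distrib_right by (subst (1) z(3)) (simp add: algebra_simps)
      also have "\<dots> = (Y - L) * t"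
        unfolding prod t_def by (simp add: distrib_left mult_ac)
      finally have "u * v * z \<in> (*) (Y - L) ` R"
        using \<open>t \<in> R\<close> by blast
      from add[OF this step(4)] show ?case
        by (simp add: algebra_simps)
    qed (use zero in simp)
  qed
  moreover have "Y - L \<in> ?T"
  proof -
    \<comment> \<open>For the other inclusion everything beside Y - L has to be cancelled.
      \<open>M\<close> is an ideal of polynomials containing
      \<open>[:- x1, 1:] * [:- x2, 1:]\<close>; elements of \<open>M\<close> nonzero at x1 and at x2
      remove these two factors.\<close>
    define M where "M = {p. (Y - L) * at_inf p \<in> ?T}"
    have M_add: "p + q \<in> M" if "p \<in> M" "q \<in> M" for p q
      using that T_add by (simp add: M_def distrib_left)
    have M_mult: "q * p \<in> M" if "p \<in> M" for p q
      using T_mult[OF _ at_inf_in_R, of "(Y - L) * at_inf p" q] that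
      by (simp add: M_def mult.left_commute)
    have trip: "u * v * w \<in> ?T" if "u \<in> ?J x1" "v \<in> ?J x2" "w \<in> ?J x3" for u v w
      by (intro ideal_prod_mult that)
    have M12: "[:- x1, 1:] * [:- x2, 1:] \<in> M"
      using trip[OF gen(1,2,4)] unfolding M_def mem_Collect_eq at_inf_mult A by (simp only: mult_ac)
    have M13: "[:- x1, 1:] * [:- x3, 1:] \<in> M"
      using trip[OF gen(1,4,3)] unfolding M_def mem_Collect_eq at_inf_mult A by (simp only: mult_ac)
    have M23: "[:- x2, 1:] * [:- x3, 1:] \<in> M"
      using trip[OF gen(4,2,3)] unfolding M_def mem_Collect_eq at_inf_mult A by (simp only: mult_ac)
    have M_sq: "smult 4 ([:m, l:]\<^sup>2) \<in> M"
    proof -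
      have "(Y - L) * (Y + L) \<in> ?T"
        using trip[OF gen(1,2,3)] by (simp add: prod)
      \<comment> \<open>The multiplier is 3 L - Y, chosen so that (3 L - Y) (Y + L) + (Y - L)^2 = 4
        L^2 is free of Y.\<close>
      hence "((Y + L) - (Y - L) - (Y - L)) * ((Y - L) * (Y + L)) \<in> ?T"
        by (rule T_mult) (intro R_diff AR)
      from T_add[OF this trip[OF gen(4,4,4)]]
      have "(Y - L) * (4 * L\<^sup>2) \<in> ?T"
        by (simp add: power2_eq_square algebra_simps)
      thus ?thesis
        by (simp add: M_def L_def del: at_inf_pCons)
    qed
    \<comment> \<open>Where L is nonzero, 4 L^2 does it. At a zero of L the point has y = 0, and
      smoothness makes x a simple root of f - L^2, so the product of the other two linear factors is
      nonzero at x.\<close>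
    have nonvanish: "\<exists>t\<in>M. poly t x \<noteq> 0"
      if "[:c, b, a, 1:] - [:m, l:]\<^sup>2 = [:- x, 1:] * ([:- x', 1:] * [:- x'', 1:])"
        "[:- x', 1:] * [:- x'', 1:] \<in> M" "x \<in> {x1, x2, x3}" for x x' x''
    proof (cases "l * x + m = 0")
      case False
      thus ?thesis
        using M_sq by (intro bexI[OF _ M_sq]) (simp add: algebra_simps)
    next
      case True
      have "pderiv ([:c, b, a, 1:] - [:m, l:]\<^sup>2) = [:- x, 1:] * pderiv ([:- x', 1:] * [:- x'', 1:]) + [:- x', 1:] * [:- x'', 1:]"
        unfolding that(1) pderiv_mult by (simp add: pderiv_pCons)
      hence "poly (pderiv ([:c, b, a, 1:] - [:m, l:]\<^sup>2)) x = poly ([:- x', 1:] * [:- x'', 1:]) x"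
        by simp
      moreover have "poly (pderiv ([:c, b, a, 1:] - [:m, l:]\<^sup>2)) x = 3 * x\<^sup>2 + 2 * a * x + b - 2 * l * (l * x + m)"
        by (simp add: pderiv_diff pderiv_power pderiv_pCons power2_eq_square algebra_simps)
      moreover have "3 * x\<^sup>2 + 2 * a * x + b \<noteq> 0"
        using on_curve[OF that(3)] True by (intro smooth) simp
      ultimately have "poly ([:- x', 1:] * [:- x'', 1:]) x \<noteq> 0"
        using True by simp
      thus ?thesis
        using that(2) by blast
    qed
    obtain t1 where t1: "t1 \<in> M" "poly t1 x1 \<noteq> 0"
      using nonvanish[OF _ M23, of x1] by (auto simp only: fac mult.assoc insert_iff)
    have "[:- x2, 1:] * 1 \<in> M"
      using poly_ideal_descend[OF M_add M_mult M12 t1] by simp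
    moreover obtain t2 where t2: "t2 \<in> M" "poly t2 x2 \<noteq> 0"
      using nonvanish[OF _ M13, of x2] by (auto simp only: fac mult_ac insert_iff)
    ultimately have "1 \<in> M"
      using poly_ideal_descend[OF M_add M_mult, of x2 1 t2] by blast
    thus ?thesis
      by (simp add: M_def)
  qed
  from T_mult[OF this] have "(*) (Y - L) ` R \<subseteq> ?T"
    by (auto simp: mult.commute[of "Y - L"])
  ultimately show ?thesis
    unfolding L_def by blast
qed

text \<open>The function X - x has its zeros at P and -P. With f - y^2 = (X - x) h, the ideal
  \<open>M\<close> of cofactors of X - x contains X - x, 2 y and h. These have no common zero: if y
  = 0 then h(x) = f'(x), which is nonzero by smoothness.\<close>

lemma ideal_prod_vertical:
  assumes P: "on_curve W (Affine x y)"
  shows "ideal_prod (point_ideal (Affine x y)) (point_ideal (Affine x (- y))) = (*) (at_inf [:- x, 1:]) ` R"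
    (is "?T = _")
proof -
  define A where "A = at_inf [:- x, 1:]"
  have AR: "A \<in> R"
    unfolding A_def by (rule at_inf_in_R)
  have yR: "fls_const y \<in> R"
    using at_inf_in_R[of "[:y:]"] by simp
  have P': "on_curve W (Affine x (- y))"
    using P by simp
  have "poly ([:c, b, a, 1:] - [:y\<^sup>2:]) x = 0"
    using P by (simp add: power2_eq_square power3_eq_cube algebra_simps)
  then obtain h where h: "[:c, b, a, 1:] - [:y\<^sup>2:] = [:- x, 1:] * h"
    by (metis dvdE poly_eq_0_iff_dvd)
  have prod: "(Y - fls_const y) * (Y + fls_const y) = A * at_inf h"
  proof -
    have "A * at_inf h = Y\<^sup>2 - at_inf [:y\<^sup>2:]"
      unfolding A_def Y_sq by (simp only: h flip: at_inf_mult at_inf_diff)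
    thus ?thesis
      by (simp add: power2_eq_square algebra_simps)
  qed
  have sub: "submodule ?T"
    by (rule submodule_ideal_prod[OF submodule_point_ideal[OF P]])
  have T_add: "z + z' \<in> ?T" if "z \<in> ?T" "z' \<in> ?T" for z z'
    using sub that unfolding submodule_def by blast
  have T_mult: "r * z \<in> ?T" if "z \<in> ?T" "r \<in> R" for r z
    using sub that unfolding submodule_def by blast
  have gen: "A \<in> point_ideal (Affine x y')" "Y - fls_const y \<in> point_ideal (Affine x y)"
    "Y + fls_const y \<in> point_ideal (Affine x (- y))" for y'
    using vertical_in_point_ideal line_in_point_ideal[of y 0 x] line_in_point_ideal[of "- y" 0 x]
    by (simp_all add: A_def)
  have "?T \<subseteq> (*) A ` R"
  proof (rule ideal_prod_subset)
    show "u + v \<in> (*) A ` R" if "u \<in> (*) A ` R" "v \<in> (*) A ` R" for u v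
      using that R_add by (auto simp flip: distrib_left)
    show "0 \<in> (*) A ` R"
      by (rule image_eqI[of _ _ 0]) (use at_inf_in_R[of 0] in simp_all)
    fix u v assume "u \<in> point_ideal (Affine x y)" and "v \<in> point_ideal (Affine x (- y))"
    obtain r s where u: "r \<in> R" "s \<in> R" "u = A * r + (Y - fls_const y) * s"
      using point_ideal_line[of u x 0 y] \<open>u \<in> _\<close> unfolding A_def by (auto simp del: at_inf_pCons) auto
    obtain r' s' where v: "r' \<in> R" "s' \<in> R" "v = A * r' + (Y + fls_const y) * s'"
      using point_ideal_line[of v x 0 "- y"] \<open>v \<in> _\<close> unfolding A_def by (auto simp del: at_inf_pCons) auto
    note * = u v
    define t where "t = r * v + (Y - fls_const y) * s * r' + at_inf h * s * s'"
    have "v \<in> R"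
      unfolding * by (intro R_intros AR yR *)
    hence "t \<in> R"
      unfolding t_def by (intro R_intros yR *)
    have "u * v = A * r * v + (Y - fls_const y) * s * (A * r') + ((Y - fls_const y) * (Y + fls_const y)) * s * s'"
      unfolding *(3) distrib_right by (subst (2) *(6)) (simp add: algebra_simps)
    also have "\<dots> = A * t"
      unfolding prod t_def by (simp add: algebra_simps)
    finally show "u * v \<in> (*) A ` R"
      using \<open>t \<in> R\<close> by blast
  qed
  moreover have "A \<in> ?T"
  proof -
    define M where "M = {p. A * at_inf p \<in> ?T}"
    have M_add: "p + q \<in> M" if "p \<in> M" "q \<in> M" for p q
      using that T_add by (simp add: M_def distrib_left)
    have M_mult: "q * p \<in> M" if "p \<in> M" for p q
      using T_mult[OF _ at_inf_in_R, of "A * at_inf p" q] that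
      by (simp add: M_def mult.left_commute)
    have 1: "[:- x, 1:] * 1 \<in> M"
      using ideal_prod_mult[OF gen(1) gen(1)] by (simp add: M_def flip: A_def del: at_inf_pCons)
    have 2: "[:2 * y:] \<in> M"
    proof -
      have "A * (Y + fls_const y) \<in> ?T" "- ((Y - fls_const y) * A) \<in> ?T"
        using ideal_prod_mult[OF gen(1,3)] T_mult[OF ideal_prod_mult[OF gen(2,1)], of "-1"] R_minus[OF one_in_R]
        by auto
      from T_add[OF this] have "A * (2 * fls_const y) \<in> ?T"
        by (simp add: algebra_simps)
      thus ?thesis
        by (simp add: M_def flip: fls_const_mult_const)
    qed
    have 3: "h \<in> M"
      using ideal_prod_mult[OF gen(2,3)] by (simp add: M_def prod)
    have "\<exists>t\<in>M. poly t x \<noteq> 0"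
    proof (cases "y = 0")
      case True
      have "pderiv ([:c, b, a, 1:] - [:y\<^sup>2:]) = [:- x, 1:] * pderiv h + h"
        unfolding h pderiv_mult by (simp add: pderiv_pCons)
      hence "poly (pderiv ([:c, b, a, 1:] - [:y\<^sup>2:])) x = poly h x"
        by simp
      moreover have "poly (pderiv ([:c, b, a, 1:] - [:y\<^sup>2:])) x = 3 * x\<^sup>2 + 2 * a * x + b"
        by (simp add: pderiv_pCons power2_eq_square algebra_simps)
      moreover have "3 * x\<^sup>2 + 2 * a * x + b \<noteq> 0"
        using P True by (intro smooth) simp
      ultimately have "poly h x \<noteq> 0"
        by metis
      thus ?thesis
        using 3 by blast
    next
      case False
      hence "poly [:2 * y:] x \<noteq> 0"
        by simp
      with 2 show ?thesis by blast
    qed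
    then obtain t where "t \<in> M" "poly t x \<noteq> 0" by blast
    from poly_ideal_descend[OF M_add M_mult 1 this] have "1 \<in> M" .
    thus ?thesis
      by (simp add: M_def)
  qed
  from T_mult[OF this] have "(*) A ` R \<subseteq> ?T"
    by (auto simp: mult.commute[of A])
  ultimately show ?thesis
    unfolding A_def by blast
qed

end

section \<open>Associativity of the chord-tangent law\<close>

fun point_neg :: "'a::uminus point \<Rightarrow> 'a point" where
  "point_neg Infinity = Infinity"
| "point_neg (Affine x y) = Affine x (- y)"

lemma point_add_Infinity_right [simp]: "point_add W P Infinity = P"
  by (cases P) auto

lemma on_curve_point_neg:
  "on_curve (Weierstrass 0 a 0 b c) P \<Longrightarrow> on_curve (Weierstrass 0 a 0 b c) (point_neg P)"
  by (cases P) auto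

lemma chord_factorization:
  fixes a b c :: "'a::field_char_0"
  assumes "x1 + x2 + x3 = l\<^sup>2 - a" "x1 * x2 + x1 * x3 + x2 * x3 = b - 2 * l * m" "x1 * x2 * x3 = m\<^sup>2 - c"
  shows "[:c, b, a, 1:] - [:m, l:]\<^sup>2 = [:- x1, 1:] * [:- x2, 1:] * [:- x3, 1:]"
proof -
  have "a = l\<^sup>2 - (x1 + x2 + x3)" "b = x1 * x2 + x1 * x3 + x2 * x3 + 2 * l * m" "c = m\<^sup>2 - x1 * x2 * x3"
    using assms by simp_all
  thus ?thesis
    by (simp add: power2_eq_square algebra_simps)
qed

lemma on_curve_point_add:
  fixes a b c :: "'a::field_char_0"
  assumes "on_curve (Weierstrass 0 a 0 b c) P" "on_curve (Weierstrass 0 a 0 b c) Q"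
  shows "on_curve (Weierstrass 0 a 0 b c) (point_add (Weierstrass 0 a 0 b c) P Q)"
proof (cases "P = Infinity \<or> Q = Infinity \<or> Q = point_neg P")
  case True
  thus ?thesis
    using assms by (cases P; cases Q) auto
next
  case False
  then obtain x1 y1 x2 y2 where PQ: "P = Affine x1 y1" "Q = Affine x2 y2" "\<not> (x1 = x2 \<and> y1 + y2 = 0)"
    by (cases P; cases Q) (auto simp: eq_neg_iff_add_eq_0 add.commute)
  obtain l m x3 where "y1 = l * x1 + m" "y2 = l * x2 + m" and *: "point_add (Weierstrass 0 a 0 b c) P Q = Affine x3 (- (l * x3 + m))"
    "x1 + x2 + x3 = l\<^sup>2 - a" "x1 * x2 + x1 * x3 + x2 * x3 = b - 2 * l * m" "x1 * x2 * x3 = m\<^sup>2 - c"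
    by (rule point_add_chord[OF assms[unfolded PQ] PQ(3), folded PQ(1,2)])
  have "poly ([:c, b, a, 1:] - [:m, l:]\<^sup>2) x3 = 0"
    unfolding chord_factorization[OF *(2-4)] poly_mult by simp
  thus ?thesis
    unfolding * by (simp add: power2_eq_square power3_eq_cube algebra_simps)
qed

context coord_ring begin

text \<open>The line through P and Q meets the curve in a third point S, and the vertical through S
  also passes through -S = P + Q. So the product of the ideals of P, Q and S is principal, and so is
  that of S and -S. Multiplying by both ideals takes the place of dividing one relation by the
  other.\<close>

lemma same_class_point_add:
  assumes "on_curve W P" "on_curve W Q"
  shows "same_class (ideal_prod (point_ideal P) (point_ideal Q)) (point_ideal (point_add W P Q))"
proof (cases "P = Infinity \<or> Q = Infinity")
  case True
  have "ideal_prod (point_ideal P) (point_ideal Q) = point_ideal (point_add W P Q)"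
    using True assms
    by (auto simp: point_ideal.simps(1) ideal_prod_R submodule_point_ideal ideal_prod_commute[of _ R])
  thus ?thesis
    by (simp add: same_class_refl)
next
  case False
  then obtain x1 y1 x2 y2 where PQ: "P = Affine x1 y1" "Q = Affine x2 y2"
    by (cases P; cases Q) auto
  have vertical: "same_class (ideal_prod (point_ideal (Affine x y)) (point_ideal (Affine x (- y)))) R"
    if "on_curve W (Affine x y)" for x y
    unfolding ideal_prod_vertical[OF that]
    using at_inf_eq_0_iff[of "[:- x, 1:]"] by (intro same_class_image) simp
  show ?thesis
  proof (cases "x1 = x2 \<and> y1 + y2 = 0")
    case True
    hence "y2 = - y1"
      by (simp add: add_eq_0_iff)
    thus ?thesis
      using vertical[of x1 y1] assms True by (simp add: PQ point_ideal.simps(1))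
  next
    case False
    obtain l m x3 where line: "y1 = l * x1 + m" "y2 = l * x2 + m"
      and add: "point_add W P Q = Affine x3 (- (l * x3 + m))"
      and "x1 + x2 + x3 = l\<^sup>2 - a" "x1 * x2 + x1 * x3 + x2 * x3 = b - 2 * l * m" "x1 * x2 * x3 = m\<^sup>2 - c"
      by (rule point_add_chord[OF assms[unfolded PQ] False, folded PQ(1,2)])
    note fac = chord_factorization[OF this(4-6)]
    let ?S = "Affine x3 (l * x3 + m)" and ?S' = "Affine x3 (- (l * x3 + m))"
    let ?T = "ideal_prod (point_ideal P) (point_ideal Q)"
    have S': "on_curve W ?S'"
      using on_curve_point_add[OF assms] add by simp
    hence S: "on_curve W ?S"
      using on_curve_point_neg[OF S'] by (simp only: point_neg.simps minus_minus)
    have T: "submodule ?T"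
      by (rule submodule_ideal_prod[OF submodule_point_ideal[OF assms(1)]])
    have "Y - at_inf [:m, l:] = elem (- [:m, l:]) 1"
      by (simp only: elem_def at_inf_minus at_inf_1) simp
    hence "Y - at_inf [:m, l:] \<noteq> 0"
      by (simp only: elem_eq_0_iff) simp
    hence "same_class (ideal_prod ?T (point_ideal ?S)) R"
      unfolding PQ line ideal_prod_line[OF fac] by (rule same_class_image)
    from same_class_prod[OF this, of "point_ideal ?S'"]
    have "same_class (ideal_prod (ideal_prod ?T (point_ideal ?S)) (point_ideal ?S')) (point_ideal ?S')"
      by (simp only: ideal_prod_R[OF submodule_point_ideal[OF S']])
    moreover have "same_class ?T (ideal_prod (ideal_prod ?T (point_ideal ?S)) (point_ideal ?S'))"
    proof -
      have "ideal_prod (ideal_prod (point_ideal ?S) (point_ideal ?S')) ?T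
          = ideal_prod (ideal_prod ?T (point_ideal ?S)) (point_ideal ?S')"
        by (rule trans[OF ideal_prod_commute ideal_prod_assoc[symmetric]])
      thus ?thesis
        using same_class_prod[OF same_class_sym[OF vertical[OF S]], of ?T]
        by (simp only: ideal_prod_R[OF T])
    qed
    ultimately show ?thesis
      unfolding add by (metis same_class_trans)
  qed
qed

text \<open>A generator k would divide X - x and Y - y, of pole orders 2 and 3. Since no factor has
  pole order 1, k has order 0 and is a constant, but a nonzero constant does not vanish at the
  point.\<close>

lemma not_same_class_R:
  assumes "on_curve W (Affine x y)"
  shows "\<not> same_class (point_ideal (Affine x y)) R"
proof
  let ?I = "point_ideal (Affine x y)"
  assume "same_class ?I R"
  then obtain g h where gh: "g \<noteq> 0" "h \<noteq> 0" "(*) g ` ?I = (*) h ` R"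
    unfolding same_class_def by blast
  define k where "k = h / g"
  have I: "?I = (*) k ` R"
  proof -
    have "?I = (*) (inverse g) ` (*) g ` ?I"
      using gh(1) by (simp add: image_image flip: mult.assoc)
    also have "\<dots> = (*) k ` R"
      unfolding gh(3) k_def by (simp add: image_image field_simps)
    finally show ?thesis .
  qed
  have "k \<in> ?I"
    unfolding I using one_in_R by (intro image_eqI[of _ _ 1]) simp_all
  then obtain p q where k: "k = elem p q" "poly p x + poly q x * y = 0"
    by (auto simp: point_ideal.simps)
  hence kR: "k \<in> R" and k0: "k \<noteq> 0"
    using gh by (auto simp: k_def)
  obtain r where r: "r \<in> R" "at_inf [:- x, 1:] = k * r"
    using vertical_in_point_ideal[of x y] unfolding I by blast
  obtain s where s: "s \<in> R" "elem [:- y:] 1 = k * s"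
  proof -
    have "elem [:- y:] 1 \<in> ?I"
      using line_in_point_ideal[of y 0 x] by (simp add: elem_def)
    with that show ?thesis
      unfolding I by blast
  qed
  have "k * r \<noteq> 0" "fls_subdegree (k * r) = - 2" "k * s \<noteq> 0" "fls_subdegree (k * s) = - 3"
    using at_inf_subdegree[of "[:- x, 1:]"] elem_subdegree[of "[:- y:]" 1]
    unfolding r(2)[symmetric] s(2)[symmetric] by (simp_all del: at_inf_pCons)
  hence deg: "fls_subdegree k + fls_subdegree r = - 2" "fls_subdegree k + fls_subdegree s = - 3"
    and "r \<noteq> 0" "s \<noteq> 0"
    by auto
  hence "fls_subdegree k = 0"
    using R_subdegree(1,2)[OF kR k0] R_subdegree(1,2)[OF r(1)] R_subdegree(1,2)[OF s(1)] by auto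
  then obtain d where "k = fls_const d"
    using R_subdegree(3)[OF kR k0] by blast
  hence "elem p q = elem [:d:] 0"
    using k by (simp add: elem_def)
  hence "p = [:d:]" "q = 0"
    unfolding elem_eq_iff by auto
  thus False
    using k k0 by simp
qed

text \<open>Adding -Q reduces the claim to the class of \<open>R\<close>. That P + (-Q) is infinity
  only for P = Q is read off from the definition of the chord law, without associativity.\<close>

lemma point_ideal_inj:
  assumes P: "on_curve W P" and Q: "on_curve W Q" and eq: "same_class (point_ideal P) (point_ideal Q)"
  shows "P = Q"
proof -
  let ?N = "point_neg Q"
  have N: "on_curve W ?N"
    using Q by (rule on_curve_point_neg)
  have "point_add W Q ?N = Infinity"
    by (cases Q) auto
  hence "same_class (ideal_prod (point_ideal Q) (point_ideal ?N)) R"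
    using same_class_point_add[OF Q N] by (simp add: point_ideal.simps(1))
  hence "same_class (point_ideal (point_add W P ?N)) R"
    using same_class_point_add[OF P N] same_class_prod[OF eq, of "point_ideal ?N"]
    by (meson same_class_sym same_class_trans)
  hence "point_add W P ?N = Infinity"
    using not_same_class_R on_curve_point_add[OF P N] by (cases "point_add W P ?N") auto
  thus "P = Q"
    by (cases P; cases Q) (auto simp: Let_def split: if_splits)
qed

lemma point_add_assoc_coord_ring:
  assumes P: "on_curve W P" and Q: "on_curve W Q" and S: "on_curve W S"
  shows "point_add W (point_add W P Q) S = point_add W P (point_add W Q S)"
proof (rule point_ideal_inj)
  let ?I = "ideal_prod (ideal_prod (point_ideal P) (point_ideal Q)) (point_ideal S)"
  have "same_class ?I (point_ideal (point_add W (point_add W P Q) S))"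
    using same_class_prod[OF same_class_point_add[OF P Q], of "point_ideal S"]
      same_class_point_add[OF on_curve_point_add[OF P Q] S] by (rule same_class_trans)
  moreover have "?I = ideal_prod (ideal_prod (point_ideal Q) (point_ideal S)) (point_ideal P)"
    by (rule trans[OF ideal_prod_assoc ideal_prod_commute])
  hence "same_class ?I (point_ideal (point_add W P (point_add W Q S)))"
    using same_class_prod[OF same_class_point_add[OF Q S], of "point_ideal P"]
      same_class_point_add[OF P on_curve_point_add[OF Q S]]
    by (simp add: ideal_prod_commute[of "point_ideal P"] same_class_trans)
  ultimately show "same_class (point_ideal (point_add W (point_add W P Q) S)) (point_ideal (point_add W P (point_add W Q S)))"
    by (meson same_class_sym same_class_trans)
qed (intro on_curve_point_add assms)+

end

theorem point_add_assoc:
  fixes a b c :: "'a::field_char_0"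
  defines "W \<equiv> Weierstrass 0 a 0 b c"
  assumes "\<And>x. x ^ 3 + a * x\<^sup>2 + b * x + c = 0 \<Longrightarrow> 3 * x\<^sup>2 + 2 * a * x + b \<noteq> 0"
    and "on_curve W P" "on_curve W Q" "on_curve W S"
  shows "point_add W (point_add W P Q) S = point_add W P (point_add W Q S)"
proof -
  obtain Y where "Y\<^sup>2 = at_inf [:c, b, a, 1:]"
    by (rule sqrt_at_inf_ex)
  then interpret coord_ring a b c Y
    by unfold_locales (use assms(2) in auto)
  show ?thesis
    using assms(3-) unfolding W_def by (rule point_add_assoc_coord_ring)
qed

section \<open>The kernel of reduction\<close>

text \<open>The last assumption places \<open>I\<close> in the Jacobson radical of \<open>A\<close>,
  as for the maximal ideal of a local ring. It supplies the integral inverses in the addition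
  formulas.\<close>

locale local_subring =
  fixes A I :: "'a::field_char_0 set"
  assumes A_one: "1 \<in> A" and A_add: "x \<in> A \<Longrightarrow> y \<in> A \<Longrightarrow> x + y \<in> A"
    and A_mult: "x \<in> A \<Longrightarrow> y \<in> A \<Longrightarrow> x * y \<in> A" and A_minus: "x \<in> A \<Longrightarrow> - x \<in> A"
    and I_zero: "0 \<in> I" and I_subset: "x \<in> I \<Longrightarrow> x \<in> A" and I_add: "x \<in> I \<Longrightarrow> y \<in> I \<Longrightarrow> x + y \<in> I"
    and I_mult_left: "x \<in> A \<Longrightarrow> y \<in> I \<Longrightarrow> x * y \<in> I" and one_notin_I: "1 \<notin> I"
    and inverse_one_plus: "x \<in> I \<Longrightarrow> inverse (1 + x) \<in> A"
begin

lemma A_diff: "x \<in> A \<Longrightarrow> y \<in> A \<Longrightarrow> x - y \<in> A"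
  using A_add[OF _ A_minus] by force

lemma A_power: "x \<in> A \<Longrightarrow> x ^ n \<in> A"
  by (induction n) (auto intro: A_one A_mult)

lemma A_of_nat: "of_nat n \<in> A"
proof (induction n)
  case 0
  show ?case using A_diff[OF A_one A_one] by simp
qed (auto intro: A_one A_add)

lemma A_numeral: "numeral n \<in> A"
  using A_of_nat[of "numeral n"] by simp

lemma I_mult_right: "x \<in> I \<Longrightarrow> y \<in> A \<Longrightarrow> x * y \<in> I"
  using I_mult_left[of y x] by (simp add: mult.commute)

lemma I_minus: "x \<in> I \<Longrightarrow> - x \<in> I"
  using I_mult_left[OF A_minus[OF A_one]] by simp

lemma I_diff: "x \<in> I \<Longrightarrow> y \<in> I \<Longrightarrow> x - y \<in> I"
  using I_add[OF _ I_minus] by force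

lemma I_power: "x \<in> I \<Longrightarrow> n > 0 \<Longrightarrow> x ^ n \<in> I"
  by (cases n) (auto intro: I_mult_right A_power I_subset)

lemmas A_intros = A_one A_add A_mult A_minus A_diff A_power A_of_nat A_numeral

lemma one_plus_nonzero: "x \<in> I \<Longrightarrow> 1 + x \<noteq> 0"
  using I_minus[of x] one_notin_I by (auto simp: add_eq_0_iff)

lemma one_minus_unit:
  assumes "x \<in> I"
  shows "1 - x \<noteq> 0" "inverse (1 - x) \<in> A"
  using one_plus_nonzero[OF I_minus[OF assms]] inverse_one_plus[OF I_minus[OF assms]] by simp_all

end

text \<open>The coordinates \<open>z = x / y\<close> and \<open>w = 1 / y\<close> are regular at the point at infinity, where both vanish.\<close>

fun z_coord :: "'a::field point \<Rightarrow> 'a" where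
  "z_coord Infinity = 0"
| "z_coord (Affine x y) = x / y"

locale formal_group = local_subring A I for A I :: "'a::field_char_0 set" +
  fixes a b :: 'a
  assumes coeffs: "a \<in> A" "b \<in> A"
begin

abbreviation "W \<equiv> Weierstrass 0 a 0 b 0"

text \<open>A condition on x / y alone would not do: near the 2-torsion point (0, 0) the quotient x
  / y can be small as well. The condition on 1 / y separates this point from infinity.\<close>

fun reduces_to_infinity :: "'a point \<Rightarrow> bool" where
  "reduces_to_infinity Infinity \<longleftrightarrow> True"
| "reduces_to_infinity (Affine x y) \<longleftrightarrow> y \<noteq> 0 \<and> x / y \<in> I \<and> 1 / y \<in> I"

lemma zw_equation:
  assumes "on_curve W (Affine x y)" "y \<noteq> 0"
  defines "z \<equiv> x / y" and "w \<equiv> 1 / y"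
  shows "w = z ^ 3 + a * z\<^sup>2 * w + b * z * w\<^sup>2"
proof -
  have y: "y\<^sup>2 = x ^ 3 + a * x\<^sup>2 + b * x"
    using assms by simp
  have "w = y\<^sup>2 / y ^ 3"
    using assms(2) by (simp add: w_def power2_eq_square power3_eq_cube)
  also have "\<dots> = z ^ 3 + a * z\<^sup>2 * w + b * z * w\<^sup>2"
    unfolding y z_def w_def using assms(2) by (simp add: field_simps power2_eq_square power3_eq_cube)
  finally show ?thesis .
qed

text \<open>Collecting the terms with w leaves w times 1 minus an element of \<open>I\<close>, which
  is a unit. So w is divisible by z^3; this replaces the power series expansion of w in z.\<close>

lemma w_in_terms_of_z:
  assumes "z \<in> I" "w \<in> I" "w = z ^ 3 + a * z\<^sup>2 * w + b * z * w\<^sup>2"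
  obtains u where "u \<in> A" "w = z ^ 3 * u"
proof -
  have "a * z\<^sup>2 + b * z * w \<in> I"
    using assms(1,2) coeffs by (intro I_add I_mult_left I_power A_mult) (auto intro: I_subset)
  note unit = one_minus_unit[OF this]
  have "w * (1 - (a * z\<^sup>2 + b * z * w)) = z ^ 3"
    using assms(3) by (simp add: algebra_simps power2_eq_square)
  hence "w = z ^ 3 * inverse (1 - (a * z\<^sup>2 + b * z * w))"
    using unit(1) by (simp add: field_simps)
  with unit(2) show ?thesis
    using that by blast
qed

lemma line_zw:
  fixes l m :: 'a
  assumes "y \<noteq> 0" "m \<noteq> 0" "y = l * x + m"
  shows "1 / y = 1 / m + (- l / m) * (x / y)"
proof -
  have "1 / m + (- l / m) * (x / y) = (y - l * x) / (m * y)"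
    using assms(1,2) by (simp add: field_simps)
  also have "\<dots> = 1 / y"
    using assms(2) by (simp add: assms(3))
  finally show ?thesis by simp
qed

text \<open>In the (z, w)-plane the line has slope -l / m and intercept 1 / m. Subtracting the
  equations of the two points gives (w1 - w2) D = (z1 - z2) N. In the application D is a unit, so
  the slope N / D is integral even for points that are congruent or equal.\<close>

lemma slope_equation:
  assumes P1: "on_curve W (Affine x1 y1)" "y1 \<noteq> 0" and P2: "on_curve W (Affine x2 y2)" "y2 \<noteq> 0"
    and e1: "x1 + x2 + x3 = l\<^sup>2 - a" and e2: "x1 * x2 + x1 * x3 + x2 * x3 = b - 2 * l * m"
    and line: "y1 = l * x1 + m" "y2 = l * x2 + m" and m: "m \<noteq> 0"
  defines "z1 \<equiv> x1 / y1" and "w1 \<equiv> 1 / y1" and "z2 \<equiv> x2 / y2" and "w2 \<equiv> 1 / y2"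
  assumes D: "1 - a * z1\<^sup>2 - b * z1 * (w1 + w2) \<noteq> 0"
  shows "(- l / m) * (1 - a * z1\<^sup>2 - b * z1 * (w1 + w2)) =
    z1\<^sup>2 + z1 * z2 + z2\<^sup>2 + a * (z1 + z2) * w2 + b * w2\<^sup>2" (is "?L * ?D = ?N")
proof -
  have w: "w1 = 1 / m + ?L * z1" "w2 = 1 / m + ?L * z2"
    unfolding z1_def w1_def z2_def w2_def
    by (rule line_zw; use P1(2) P2(2) m line in simp)+
  have eq1: "w1 = z1 ^ 3 + a * z1\<^sup>2 * w1 + b * z1 * w1\<^sup>2"
    and eq2: "w2 = z2 ^ 3 + a * z2\<^sup>2 * w2 + b * z2 * w2\<^sup>2"
    using zw_equation[OF P1] zw_equation[OF P2] by (simp_all add: z1_def z2_def w1_def w2_def)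
  have "(w1 - w2) * ?D - (z1 - z2) * ?N =
      (w1 - (z1 ^ 3 + a * z1\<^sup>2 * w1 + b * z1 * w1\<^sup>2)) - (w2 - (z2 ^ 3 + a * z2\<^sup>2 * w2 + b * z2 * w2\<^sup>2))"
    by (simp add: algebra_simps power2_eq_square power3_eq_cube)
  also have "\<dots> = 0"
    using eq1 eq2 by simp
  finally have diff: "(w1 - w2) * ?D = (z1 - z2) * ?N"
    by simp
  show ?thesis
  proof (cases "z1 = z2")
    case False
    have "w1 - w2 = ?L * (z1 - z2)"
      unfolding w by (simp only: right_diff_distrib add_diff_cancel_left)
    with diff have eq: "(z1 - z2) * (?L * ?D) = (z1 - z2) * ?N"
      by (simp add: mult_ac)
    have "z1 - z2 \<noteq> 0"
      using False by simp
    from mult_left_cancel[OF this, THEN iffD1, OF eq] show ?thesis .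
  next
    case True
    hence "w1 = w2"
      using w by simp
    hence y: "y1 = y2"
      using P1(2) P2(2) by (simp add: w1_def w2_def)
    hence x: "x1 = x2"
      using True P1(2) by (simp add: z1_def z2_def)
    have sq: "y1 * y1 = x1 * x1 * x1 + a * x1 * x1 + b * x1"
      using P1 by (simp add: power2_eq_square power3_eq_cube)
    \<comment> \<open>For equal points nothing can be divided by z1 - z2; the first two Vieta
      relations with x1 = x2 give back the tangent slope.\<close>
    have tangent: "2 * l * y1 = 3 * x1 * x1 + 2 * a * x1 + b"
    proof -
      have x3: "x3 = l\<^sup>2 - a - 2 * x1"
        using e1 x by (simp add: algebra_simps)
      have b: "b = 2 * l * m + (x1 * x1 + 2 * x1 * x3)"
        using e2 x by (simp add: algebra_simps)
      show ?thesis
        unfolding line(1) by (subst b) (simp add: x3 algebra_simps power2_eq_square)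
    qed
    have "2 * m * y1 = 2 * (y1 * y1) - x1 * (2 * l * y1)"
      using line(1) by (simp add: algebra_simps)
    also have "\<dots> = - (y1 * y1 - a * x1 * x1 - 2 * b * x1)"
      unfolding sq tangent by (simp add: algebra_simps)
    finally have my: "2 * m * y1 = - (y1 * y1 - a * x1 * x1 - 2 * b * x1)" .
    have D': "?D = (y1 * y1 - a * x1 * x1 - 2 * b * x1) / (y1 * y1)"
      using P1(2) by (simp add: z1_def w1_def w2_def flip: y, simp add: field_simps power2_eq_square)
    have "?N = (3 * x1 * x1 + 2 * a * x1 + b) / (y1 * y1)"
      using P1(2) by (simp add: z1_def z2_def w1_def w2_def flip: y x, simp add: field_simps power2_eq_square)
    also have "\<dots> = 2 * l / y1"
      unfolding tangent[symmetric] using P1(2) by simp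
    finally have N': "?N = 2 * l / y1" .
    have "?L * ?D = (l / m) * (2 * m * y1) / (y1 * y1)"
    proof -
      have "?L * (k / (y1 * y1)) = (l / m) * (- k) / (y1 * y1)" for k
        by simp
      thus ?thesis
        unfolding my D' .
    qed
    also have "\<dots> = ?N"
      unfolding N' using m P1(2) by (simp add: field_simps)
    finally show ?thesis .
  qed
qed

text \<open>Addition agrees with z1 + z2 to first order. Writing both coordinates as multiples of a
  common z shows that the error is a multiple of z^2, not just an element of \<open>I\<close>, so
  that one factor z survives when multiples of a point are compared with the point itself.\<close>

lemma z_coord_point_add:
  assumes P: "on_curve W P" "reduces_to_infinity P" and Q: "on_curve W Q" "reduces_to_infinity Q"
    and z: "z \<in> I" and \<alpha>: "\<alpha> \<in> A" "z_coord P = \<alpha> * z" and \<beta>: "\<beta> \<in> A" "z_coord Q = \<beta> * z"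
  shows "reduces_to_infinity (point_add W P Q) \<and>
    (\<exists>\<gamma>\<in>A. z_coord (point_add W P Q) = (\<alpha> + \<beta> + \<gamma> * z) * z)"
proof -
  have zero: "\<exists>\<gamma>\<in>A. t = (\<alpha> + \<beta> + \<gamma> * z) * z" if "t = (\<alpha> + \<beta>) * z" for t
    using that A_of_nat[of 0] by (intro bexI[of _ 0]) simp_all
  show ?thesis
  proof (cases "P = Infinity \<or> Q = Infinity")
    case True
    hence "reduces_to_infinity (point_add W P Q) \<and> z_coord (point_add W P Q) = (\<alpha> + \<beta>) * z"
      using P Q \<alpha> \<beta> by (auto simp: distrib_right)
    thus ?thesis
      using zero by blast
  next
    case False
    then obtain x1 y1 x2 y2 where PQ: "P = Affine x1 y1" "Q = Affine x2 y2"
      by (cases P; cases Q) auto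
    have y: "y1 \<noteq> 0" "y2 \<noteq> 0"
      using P Q PQ by simp_all
    define z1 w1 z2 w2 where zw: "z1 = x1 / y1" "w1 = 1 / y1" "z2 = x2 / y2" "w2 = 1 / y2"
    have I: "z1 \<in> I" "w1 \<in> I" "z2 \<in> I" "w2 \<in> I"
      using P Q PQ by (simp_all add: zw)
    note A = I[THEN I_subset]
    have z12: "z1 = \<alpha> * z" "z2 = \<beta> * z"
      using \<alpha> \<beta> PQ by (simp_all add: zw)
    have curve: "w1 = z1 ^ 3 + a * z1\<^sup>2 * w1 + b * z1 * w1\<^sup>2" "w2 = z2 ^ 3 + a * z2\<^sup>2 * w2 + b * z2 * w2\<^sup>2"
      using zw_equation P Q y PQ by (simp_all add: zw)
    obtain u1 where u1: "u1 \<in> A" "w1 = z1 ^ 3 * u1"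
      using w_in_terms_of_z[OF I(1,2) curve(1)] .
    obtain u2 where u2: "u2 \<in> A" "w2 = z2 ^ 3 * u2"
      using w_in_terms_of_z[OF I(3,4) curve(2)] .
    show ?thesis
    proof (cases "x1 = x2 \<and> y1 + y2 = 0")
      case True
      hence "(\<alpha> + \<beta>) * z = 0"
        using y by (simp add: distrib_right add_eq_0_iff zw flip: z12)
      thus ?thesis
        using True zero[of 0] by (simp add: PQ)
    next
      case False
      obtain l m x3 where line: "y1 = l * x1 + m" "y2 = l * x2 + m"
        and add: "point_add W P Q = Affine x3 (- (l * x3 + m))"
        and e1: "x1 + x2 + x3 = l\<^sup>2 - a" and e2: "x1 * x2 + x1 * x3 + x2 * x3 = b - 2 * l * m"
        and e3: "x1 * x2 * x3 = m\<^sup>2 - 0"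
        by (rule point_add_chord[OF P(1)[unfolded PQ] Q(1)[unfolded PQ] False, folded PQ(1,2)])
      have D: "1 - (a * z1\<^sup>2 + b * z1 * (w1 + w2)) \<noteq> 0" "inverse (1 - (a * z1\<^sup>2 + b * z1 * (w1 + w2))) \<in> A"
        by (rule one_minus_unit, intro I_add I_mult_left I_power A_mult coeffs A I; simp)+
      \<comment> \<open>A line through the origin would force P = Q and x1^2 = b. Then z1^2 = b
        w1^2, and as w1 is divisible by z1^3, cancelling z1^2 would put 1 into
        \<open>I\<close>.\<close>
      have m: "m \<noteq> 0"
      proof
        assume m: "m = 0"
        have l: "l \<noteq> 0" "x1 \<noteq> 0" "x2 \<noteq> 0"
          using y line m by auto
        have "z1 = z2"
          using l line m by (simp add: zw)
        have "(w1 - w2) * (1 - (a * z1\<^sup>2 + b * z1 * (w1 + w2))) =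
            (w1 - (z1 ^ 3 + a * z1\<^sup>2 * w1 + b * z1 * w1\<^sup>2)) - (w2 - (z2 ^ 3 + a * z2\<^sup>2 * w2 + b * z2 * w2\<^sup>2))"
          unfolding \<open>z1 = z2\<close> by (simp add: algebra_simps power2_eq_square power3_eq_cube)
        also have "\<dots> = 0"
          using curve by simp
        finally have "w1 = w2"
          using D(1) by simp
        hence "y1 = y2"
          using y by (simp add: zw)
        hence "x1 = x2"
          using line m l by simp
        moreover have "x3 = 0"
          using e3 l m by simp
        ultimately have "x1 * x1 = b"
          using e2 m by simp
        hence "z1 * z1 = b * (w1 * w1)"
          using y by (simp add: zw)
        also have "\<dots> = z1 * z1 * (b * z1 ^ 4 * u1\<^sup>2)"
          unfolding u1(2) by (simp add: power2_eq_square numeral_eq_Suc algebra_simps)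
        finally have "1 - b * z1 ^ 4 * u1\<^sup>2 = 0"
          using l y by (simp add: zw)
        moreover have "b * z1 ^ 4 * u1\<^sup>2 \<in> I"
          using coeffs u1(1) by (intro I_mult_right I_mult_left I_power I A_power) simp_all
        ultimately show False
          using one_minus_unit(1) by blast
      qed
      define L where "L = - l / m"
      define \<nu> where "\<nu> = w1 - L * z1"
      have \<nu>_eq: "\<nu> = 1 / m"
        using line_zw[OF y(1) m line(1)] by (simp add: \<nu>_def L_def zw)
      define N where "N = z1\<^sup>2 + z1 * z2 + z2\<^sup>2 + a * (z1 + z2) * w2 + b * w2\<^sup>2"
      have "N \<in> I"
        unfolding N_def by (intro I_add I_mult_left I_power A_mult A_add coeffs A I; simp)
      have "L * (1 - (a * z1\<^sup>2 + b * z1 * (w1 + w2))) = N"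
        using slope_equation[OF P(1)[unfolded PQ] y(1) Q(1)[unfolded PQ] y(2) e1 e2 line m] D(1)
        by (simp add: zw L_def N_def diff_diff_eq)
      hence L_eq: "L = N * inverse (1 - (a * z1\<^sup>2 + b * z1 * (w1 + w2)))"
        using D(1) by (simp add: field_simps)
      hence L: "L \<in> I"
        using I_mult_right[OF \<open>N \<in> I\<close> D(2)] L_eq by simp
      \<comment> \<open>Substituting w = L z + \<nu> into the curve gives a cubic in z with leading
        coefficient G and quadratic coefficient \<nu> (a + 2 b L). The equation \<open>sum\<close>
        below is its Vieta relation for the sum of the roots.\<close>
      define G where "G = 1 + (a * L + b * L\<^sup>2)"
      have G: "G \<noteq> 0" "inverse G \<in> A"
        unfolding G_def
        by (rule one_plus_nonzero inverse_one_plus, intro I_add I_mult_left I_power coeffs L; simp)+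
      \<comment> \<open>The third intersection is (x3, y3). The sum P + Q is its negative, so its
        z-coordinate is - x3 / y3.\<close>
      define y3 where "y3 = l * x3 + m"
      have Lm: "L * m = - l"
        using m by (simp add: L_def)
      have "y1 * y2 * y3 = l ^ 3 * (x1 * x2 * x3) + l\<^sup>2 * m * (x1 * x2 + x1 * x3 + x2 * x3)
          + l * m\<^sup>2 * (x1 + x2 + x3) + m ^ 3"
        unfolding line y3_def by (simp add: algebra_simps power2_eq_square power3_eq_cube)
      also have "\<dots> = m * (m * m + a * (- l) * m + b * ((- l) * (- l)))"
        unfolding e1 e2 e3 by (simp add: algebra_simps power2_eq_square power3_eq_cube)
      also have "\<dots> = m ^ 3 * G"
        unfolding G_def Lm[symmetric] by (simp add: algebra_simps power2_eq_square power3_eq_cube)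
      finally have yyy: "y1 * y2 * y3 = m ^ 3 * G" .
      hence y3: "y3 \<noteq> 0"
        using G m by auto
      have "x1 * y2 * y3 + x2 * y1 * y3 + x3 * y1 * y2 = 3 * l\<^sup>2 * (x1 * x2 * x3)
          + 2 * l * m * (x1 * x2 + x1 * x3 + x2 * x3) + m\<^sup>2 * (x1 + x2 + x3)"
        unfolding line y3_def by (simp add: algebra_simps power2_eq_square power3_eq_cube)
      also have "\<dots> = - (m * (a * m + 2 * b * (- l)))"
        unfolding e1 e2 e3 by (simp add: algebra_simps power2_eq_square power3_eq_cube)
      also have "\<dots> = - (m\<^sup>2 * (a + 2 * b * L))"
        unfolding Lm[symmetric] by (simp add: algebra_simps power2_eq_square power3_eq_cube)
      finally have xyy: "x1 * y2 * y3 + x2 * y1 * y3 + x3 * y1 * y2 = - (m\<^sup>2 * (a + 2 * b * L))" .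
      have "z1 + z2 + x3 / y3 = (x1 * y2 * y3 + x2 * y1 * y3 + x3 * y1 * y2) / (y1 * y2 * y3)"
        using y y3 by (simp add: zw field_simps)
      also have "\<dots> = - (\<nu> * (a + 2 * b * L) * inverse G)"
        unfolding xyy yyy \<nu>_eq using m G by (simp add: field_simps power2_eq_square power3_eq_cube)
      finally have sum: "z1 + z2 + x3 / y3 = - (\<nu> * (a + 2 * b * L) * inverse G)" .
      have "- (x3 / y3) = z1 + z2 - (z1 + z2 + x3 / y3)"
        by simp
      hence z3: "- (x3 / y3) = z1 + z2 + \<nu> * (a + 2 * b * L) * inverse G"
        unfolding sum by simp
      obtain k where k: "k \<in> A" "\<nu> = k * z * z"
      proof -
        \<comment> \<open>The term w1 contributes z^3, and L and z1 contribute one factor z each, so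
          the intercept \<nu> = w1 - L z1 is divisible by z^2; k is the quotient.\<close>
        define k where "k = \<alpha> ^ 3 * z * u1 - (\<alpha>\<^sup>2 * z + \<alpha> * \<beta> * z + \<beta>\<^sup>2 * z + a * (\<alpha> + \<beta>) * w2
          + b * \<beta> ^ 3 * z\<^sup>2 * u2 * w2) * inverse (1 - (a * z1\<^sup>2 + b * z1 * (w1 + w2))) * \<alpha>"
        have "k \<in> A"
          unfolding k_def using \<alpha> \<beta> z u1 u2 coeffs A D(2) by (intro A_intros) (auto intro: I_subset)
        moreover have "N = (\<alpha>\<^sup>2 * z + \<alpha> * \<beta> * z + \<beta>\<^sup>2 * z + a * (\<alpha> + \<beta>) * w2 + b * \<beta> ^ 3 * z\<^sup>2 * u2 * w2) * z"
        proof -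
          have "b * w2\<^sup>2 = b * (z2 ^ 3 * u2) * w2"
            by (simp add: power2_eq_square flip: u2(2))
          thus ?thesis
            unfolding N_def z12 by (simp add: algebra_simps power2_eq_square power3_eq_cube)
        qed
        hence "\<nu> = k * z * z"
          unfolding \<nu>_def L_eq k_def by (subst u1(2)) (simp add: z12 algebra_simps power2_eq_square power3_eq_cube)
        ultimately show ?thesis
          by (rule that)
      qed
      define \<gamma> where "\<gamma> = k * (a + 2 * b * L) * inverse G"
      have "\<gamma> \<in> A"
        unfolding \<gamma>_def using k coeffs G L by (intro A_intros) (auto intro: I_subset)
      have z3': "- (x3 / y3) = (\<alpha> + \<beta> + \<gamma> * z) * z"
        unfolding z3 z12 k \<gamma>_def by (simp add: algebra_simps)
      have "(\<alpha> + \<beta> + \<gamma> * z) * z \<in> I"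
        using \<open>\<gamma> \<in> A\<close> \<alpha> \<beta> z by (intro I_mult_left A_intros) (auto intro: I_subset)
      hence z3I: "- (x3 / y3) \<in> I"
        by (simp add: z3')
      have "- (1 / y3) = L * (- (x3 / y3)) - \<nu>"
        using line_zw[OF y3 m y3_def] by (simp add: \<nu>_eq L_def)
      moreover have "\<dots> \<in> I"
        unfolding \<nu>_def using z3I L I by (intro I_diff I_mult_left) (auto intro: I_subset)
      ultimately have "- (1 / y3) \<in> I"
        by simp
      thus ?thesis
        using z3I z3' \<open>\<gamma> \<in> A\<close> y3 unfolding add y3_def[symmetric] by auto
    qed
  qed
qed

end

section \<open>Torsion and reduction modulo two primes\<close>

text \<open>Powers depend only on the operation and the neutral element. Torsion can therefore be
  studied over the whole field, where sums are rational by default.\<close>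

lemma nat_pow_point_group:
  "P [^]\<^bsub>point_group W F\<^esub> (k::nat) = P [^]\<^bsub>point_group W UNIV\<^esub> k"
  by (induction k) (simp_all add: nat_pow_def point_group_def)

lemma monoid_point_group:
  fixes a b c :: "'a::field_char_0"
  assumes "\<And>x. x ^ 3 + a * x\<^sup>2 + b * x + c = 0 \<Longrightarrow> 3 * x\<^sup>2 + 2 * a * x + b \<noteq> 0"
  shows "monoid (point_group (Weierstrass 0 a 0 b c) UNIV)"
    (is "monoid ?E")
proof (rule monoidI)
  show "x \<otimes>\<^bsub>?E\<^esub> y \<otimes>\<^bsub>?E\<^esub> z = x \<otimes>\<^bsub>?E\<^esub> (y \<otimes>\<^bsub>?E\<^esub> z)"
    if "x \<in> carrier ?E" "y \<in> carrier ?E" "z \<in> carrier ?E" for x y z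
    using point_add_assoc[where P = x and Q = y and S = z, OF assms] that by (simp add: point_group_def rational_points_def)
qed (simp_all add: point_group_def rational_points_def on_curve_point_add)

context formal_group begin

abbreviation "E \<equiv> point_group W UNIV"

lemma carrier_E: "P \<in> carrier E \<longleftrightarrow> on_curve W P"
  by (simp add: point_group_def rational_points_def)

lemma mult_E: "P \<otimes>\<^bsub>E\<^esub> Q = point_add W P Q" and one_E: "\<one>\<^bsub>E\<^esub> = Infinity"
  by (simp_all add: point_group_def)

lemma z_coord_multiple:
  assumes "monoid E" "on_curve W P" "reduces_to_infinity P"
  shows "reduces_to_infinity (P [^]\<^bsub>E\<^esub> (k::nat)) \<and>
    (\<exists>\<mu>\<in>I. z_coord (P [^]\<^bsub>E\<^esub> k) = (of_nat k + \<mu>) * z_coord P)"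
proof -
  interpret monoid E by fact
  have z: "z_coord P \<in> I"
    using assms(3) by (cases P) (auto intro: I_zero)
  show ?thesis
  proof (induction k)
    case 0
    show ?case
      using I_zero by (auto simp: one_E intro: bexI[of _ 0])
  next
    case (Suc k)
    then obtain \<mu> where \<mu>: "\<mu> \<in> I" "z_coord (P [^]\<^bsub>E\<^esub> k) = (of_nat k + \<mu>) * z_coord P"
      by blast
    have "on_curve W (P [^]\<^bsub>E\<^esub> k)"
      using nat_pow_closed[of P k] assms(2) by (simp add: carrier_E)
    moreover have "of_nat k + \<mu> \<in> A"
      using \<mu>(1) by (intro A_intros) (rule I_subset)
    ultimately obtain \<gamma> where "\<gamma> \<in> A"
      "reduces_to_infinity (point_add W (P [^]\<^bsub>E\<^esub> k) P)"
      "z_coord (point_add W (P [^]\<^bsub>E\<^esub> k) P) = (of_nat k + \<mu> + 1 + \<gamma> * z_coord P) * z_coord P"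
      using z_coord_point_add[of "P [^]\<^bsub>E\<^esub> k" P "z_coord P" "of_nat k + \<mu>" 1] Suc assms \<mu> z A_one
      by auto
    moreover from this have "\<mu> + \<gamma> * z_coord P \<in> I"
      using \<mu> z by (intro I_add I_mult_left)
    ultimately show ?case
      by (auto simp: mult_E algebra_simps intro!: bexI[of _ "\<mu> + \<gamma> * z_coord P"])
  qed
qed

text \<open>With k invertible, k + \<mu> is nonzero, so z(P) = 0. An affine point with z = 0 has x =
  0 and then y = 0, contrary to its reduction to infinity.\<close>

lemma no_torsion_of_unit_order:
  assumes "monoid E" "on_curve W P" "reduces_to_infinity P"
    and "P [^]\<^bsub>E\<^esub> (k::nat) = Infinity" and v: "v \<in> A" "of_nat k * v = 1"
  shows "P = Infinity"
proof (cases P)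
  case (Affine x y)
  obtain \<mu> where \<mu>: "\<mu> \<in> I" "(of_nat k + \<mu>) * z_coord P = 0"
    using z_coord_multiple[OF assms(1-3), of k] assms(4) by auto
  have "1 + v * \<mu> \<noteq> 0"
    using \<mu>(1) v(1) by (intro one_plus_nonzero I_mult_left)
  moreover have "1 + v * \<mu> = v * (of_nat k + \<mu>)"
    using v(2) by (simp add: algebra_simps)
  ultimately have "z_coord P = 0"
    using \<mu>(2) by auto
  thus ?thesis
    using assms(2,3) by (auto simp: Affine)
qed

end

text \<open>Write k = j l with l prime. The multiple j Q lies in both kernels and is killed by l,
  which is invertible in one of the two rings; so j Q is already infinity and the induction
  continues with j.\<close>

lemma no_torsion_of_two_primes:
  fixes a b :: "'a::field_char_0"
  defines "E \<equiv> point_group (Weierstrass 0 a 0 b 0) UNIV"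
  assumes fg1: "formal_group A1 I1 a b" and fg2: "formal_group A2 I2 a b"
    and mon: "monoid E"
    and unit: "\<And>l::nat. prime l \<Longrightarrow> \<exists>v. of_nat l * v = 1 \<and> (v \<in> A1 \<or> v \<in> A2)"
    and "on_curve (Weierstrass 0 a 0 b 0) Q"
    and "formal_group.reduces_to_infinity I1 Q" "formal_group.reduces_to_infinity I2 Q"
    and "(k::nat) > 0" "Q [^]\<^bsub>E\<^esub> k = Infinity"
  shows "Q = Infinity"
  using assms(9,10)
proof (induction k rule: less_induct)
  case (less k)
  interpret monoid E by fact
  have Q: "Q \<in> carrier E"
    using assms(6) by (simp add: E_def point_group_def rational_points_def)
  show ?case
  proof (cases "k = 1")
    case True
    thus ?thesis
      using less.prems Q by simp
  next
    case False
    then obtain l where l: "prime l" "l dvd k"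
      using prime_factor_nat by blast
    then obtain j where j: "k = j * l"
      by (metis dvdE mult.commute)
    have "0 < j" "j < k"
      using j less.prems(1) prime_gt_1_nat[OF l(1)] by auto
    let ?R = "Q [^]\<^bsub>E\<^esub> j"
    have R: "?R [^]\<^bsub>E\<^esub> l = Infinity"
      using less.prems(2) Q by (simp add: j nat_pow_pow)
    have "on_curve (Weierstrass 0 a 0 b 0) ?R"
      using nat_pow_closed[OF Q, of j] by (simp add: E_def point_group_def rational_points_def)
    moreover have "formal_group.reduces_to_infinity I1 ?R" "formal_group.reduces_to_infinity I2 ?R"
      using formal_group.z_coord_multiple[OF fg1 mon[unfolded E_def] assms(6,7), folded E_def]
        formal_group.z_coord_multiple[OF fg2 mon[unfolded E_def] assms(6,8), folded E_def] by blast+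
    ultimately have "?R = Infinity"
      using unit[OF l(1)] R formal_group.no_torsion_of_unit_order[OF fg1 mon[unfolded E_def], folded E_def]
        formal_group.no_torsion_of_unit_order[OF fg2 mon[unfolded E_def], folded E_def] by blast
    thus ?thesis
      using less.IH \<open>0 < j\<close> \<open>j < k\<close> by blast
  qed
qed

section \<open>The local ring at a prime of the integers\<close>

lemma ring_of_type_algebra_simps [simp]:
  "carrier ring_of_type_algebra = UNIV" "x \<otimes>\<^bsub>ring_of_type_algebra\<^esub> y = x * y"
  "\<one>\<^bsub>ring_of_type_algebra\<^esub> = 1" "\<zero>\<^bsub>ring_of_type_algebra\<^esub> = 0"
  "x \<oplus>\<^bsub>ring_of_type_algebra\<^esub> y = x + y"
  by (simp_all add: ring_of_type_algebra_def)

lemma prime_ofD: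
  assumes "prime_of L p"
  defines "OL \<equiv> ring_of_integers L"
  shows "1 \<in> OL" "x \<in> OL \<Longrightarrow> y \<in> OL \<Longrightarrow> x + y \<in> OL" "x \<in> OL \<Longrightarrow> y \<in> OL \<Longrightarrow> x * y \<in> OL"
    "x \<in> OL \<Longrightarrow> - x \<in> OL" "x \<in> p \<Longrightarrow> x \<in> OL" "0 \<in> p" "x \<in> p \<Longrightarrow> y \<in> p \<Longrightarrow> x + y \<in> p"
    "x \<in> OL \<Longrightarrow> y \<in> p \<Longrightarrow> x * y \<in> p" "1 \<notin> p"
    "x \<in> OL \<Longrightarrow> y \<in> OL \<Longrightarrow> x * y \<in> p \<Longrightarrow> x \<in> p \<or> y \<in> p"
proof -
  interpret primeideal p "Kbar\<lparr>carrier := OL\<rparr>"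
    using assms by (simp add: prime_of_def)
  show "1 \<in> OL" "x \<in> OL \<Longrightarrow> y \<in> OL \<Longrightarrow> x + y \<in> OL" "x \<in> OL \<Longrightarrow> y \<in> OL \<Longrightarrow> x * y \<in> OL"
    using one_closed a_closed m_closed by simp_all
  show "- x \<in> OL" if "x \<in> OL"
  proof -
    have "x + a_inv (Kbar\<lparr>carrier := OL\<rparr>) x = 0"
      using r_neg[of x] that by simp
    from group_add_class.minus_unique[OF this] show ?thesis
      using a_inv_closed[of x] that by simp
  qed
  show "x \<in> p \<Longrightarrow> x \<in> OL" "0 \<in> p" "x \<in> p \<Longrightarrow> y \<in> p \<Longrightarrow> x + y \<in> p"
    "x \<in> OL \<Longrightarrow> y \<in> p \<Longrightarrow> x * y \<in> p"
    using a_subset additive_subgroup.zero_closed[OF is_additive_subgroup]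
      additive_subgroup.a_closed[OF is_additive_subgroup] I_l_closed by auto
  show "1 \<notin> p"
    using one_imp_carrier I_notcarr by auto
  show "x \<in> OL \<Longrightarrow> y \<in> OL \<Longrightarrow> x * y \<in> p \<Longrightarrow> x \<in> p \<or> y \<in> p"
    using I_prime[of x y] by simp
qed

definition local_max :: "'a::field_char_0 set \<Rightarrow> 'a set \<Rightarrow> 'a set" where
  "local_max L p = {a / b | a b. a \<in> p \<and> b \<in> ring_of_integers L \<and> b \<notin> p}"

lemma local_subring_local_ring:
  assumes "prime_of L p"
  shows "local_subring (local_ring L p) (local_max L p)"
proof -
  note D = prime_ofD[OF assms]
  have nz: "b \<noteq> 0" if "b \<notin> p" for b
    using D(6) that by auto
  have den: "b * d \<in> ring_of_integers L \<and> b * d \<notin> p"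
    if "b \<in> ring_of_integers L" "b \<notin> p" "d \<in> ring_of_integers L" "d \<notin> p" for b d
    using that D(3,10) by blast
  have frac: "a / b + c / d = (a * d + c * b) / (b * d)" "a / b * (c / d) = (a * c) / (b * d)"
    if "b \<notin> p" "d \<notin> p" for a b c d :: 'a
    using nz that by (simp_all add: field_simps)
  have ringI: "a / b \<in> local_ring L p" if "a \<in> ring_of_integers L" "b \<in> ring_of_integers L" "b \<notin> p" for a b
    unfolding local_ring_def using that by blast
  have maxI: "a / b \<in> local_max L p" if "a \<in> p" "b \<in> ring_of_integers L" "b \<notin> p" for a b
    unfolding local_max_def using that by blast
  show ?thesis
  proof unfold_locales
    show "1 \<in> local_ring L p"
      unfolding local_ring_def using D(1,9) by (intro CollectI exI[of _ 1]) simp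
    show "0 \<in> local_max L p"
      unfolding local_max_def using D(1,6,9) by (intro CollectI exI[of _ 0] exI[of _ 1]) simp
    show "1 \<notin> local_max L p"
      unfolding local_max_def using nz by (auto simp: divide_eq_1_iff)
  next
    fix x y assume "x \<in> local_ring L p" "y \<in> local_ring L p"
    then obtain a b c d where *: "x = a / b" "y = c / d" "a \<in> ring_of_integers L" "b \<in> ring_of_integers L" "b \<notin> p"
      "c \<in> ring_of_integers L" "d \<in> ring_of_integers L" "d \<notin> p"
      unfolding local_ring_def by blast
    show "x + y \<in> local_ring L p" "x * y \<in> local_ring L p"
      unfolding *(1,2) frac[OF *(5,8)]
      using den[OF *(4,5,7,8)] * by (intro ringI D(2,3); simp)+
  next
    fix x assume "x \<in> local_ring L p"
    then obtain a b where *: "x = a / b" "a \<in> ring_of_integers L" "b \<in> ring_of_integers L" "b \<notin> p"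
      unfolding local_ring_def by blast
    have "- x = (- a) / b"
      using * by simp
    thus "- x \<in> local_ring L p"
      using ringI[OF D(4)] * by simp
  next
    fix x assume "x \<in> local_max L p"
    thus "x \<in> local_ring L p"
      unfolding local_ring_def local_max_def using D(5) by blast
  next
    fix x y assume "x \<in> local_max L p" "y \<in> local_max L p"
    then obtain a b c d where *: "x = a / b" "y = c / d" "a \<in> p" "b \<in> ring_of_integers L" "b \<notin> p"
      "c \<in> p" "d \<in> ring_of_integers L" "d \<notin> p"
      unfolding local_max_def by blast
    have "a * d + c * b \<in> p"
      using D(7)[OF D(8) D(8), OF *(7,3,4,6)] by (simp add: mult.commute)
    thus "x + y \<in> local_max L p"
      unfolding *(1,2) frac[OF *(5,8)] using den[OF *(4,5,7,8)] by (intro maxI) simp_all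
  next
    fix x y assume "x \<in> local_ring L p" "y \<in> local_max L p"
    then obtain a b c d where *: "x = a / b" "y = c / d" "a \<in> ring_of_integers L" "b \<in> ring_of_integers L" "b \<notin> p"
      "c \<in> p" "d \<in> ring_of_integers L" "d \<notin> p"
      unfolding local_ring_def local_max_def by blast
    show "x * y \<in> local_max L p"
      unfolding *(1,2) frac[OF *(5,8)] using den[OF *(4,5,7,8)] * by (intro maxI D(8)) simp_all
  next
    fix x assume "x \<in> local_max L p"
    then obtain a b where *: "x = a / b" "a \<in> p" "b \<in> ring_of_integers L" "b \<notin> p"
      unfolding local_max_def by blast
    \<comment> \<open>The inverse of 1 + a / b is b / (b + a), so the new denominator must avoid
      p.\<close>
    have "b + a \<notin> p"
    proof
      assume "b + a \<in> p"
      moreover have "- a \<in> p"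
        using D(8)[OF D(4)[OF D(1)] *(2)] by simp
      ultimately have "b + a + - a \<in> p"
        by (rule D(7))
      thus False
        using *(4) by simp
    qed
    moreover have "b + a \<in> ring_of_integers L"
      using D(2,5) * by blast
    moreover have "inverse (1 + x) = b / (b + a)"
      using nz[OF *(4)] nz[OF \<open>b + a \<notin> p\<close>] by (simp add: * field_simps)
    ultimately show "inverse (1 + x) \<in> local_ring L p"
      using ringI *(3) by simp
  qed
qed

lemma integers_local_ring:
  assumes "prime_of L p"
  shows "x \<in> ring_of_integers L \<Longrightarrow> x \<in> local_ring L p" "x \<in> p \<Longrightarrow> x \<in> local_max L p"
  using prime_ofD(1,9)[OF assms] unfolding local_ring_def local_max_def by force+

text \<open>An integer of p not divisible by l would be coprime to l, and a Bezout relation would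
  put 1 into p.\<close>

lemma of_int_in_prime_imp_lies_over:
  assumes p: "prime_of L p" and l: "prime (l::int)" "of_int l \<in> p"
  shows "lies_over p l"
proof -
  note D = prime_ofD[OF p]
  have nat: "of_nat n \<in> ring_of_integers L" for n
  proof (induction n)
    case 0
    show ?case using D(5,6) by simp
  qed (use D(1,2) in auto)
  have int: "of_int k \<in> ring_of_integers L" for k
    using nat[of "nat \<bar>k\<bar>"] D(4)[OF nat[of "nat \<bar>k\<bar>"]] by (cases "k \<ge> 0") (auto simp: of_nat_nat)
  have mult: "of_int (l * k) \<in> p" for k
    using D(8)[OF int l(2), of k] by (simp add: mult.commute)
  have dvd: "l dvd j" if "of_int j \<in> p" for j
  proof (rule ccontr)
    assume "\<not> l dvd j"
    hence "coprime l j"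
      using l(1) by (simp add: prime_imp_coprime)
    then obtain s t where "s * l + t * j = 1"
      by (metis bezout_int coprime_iff_gcd_eq_1)
    moreover have "of_int s * of_int l + of_int t * of_int j \<in> p"
      using D(7,8) int l(2) that by blast
    ultimately have "1 \<in> p"
      by (metis of_int_1 of_int_add of_int_mult)
    thus False
      using D(9) by simp
  qed
  have "p \<inter> \<int> \<subseteq> {of_int (l * k) | k. True}"
  proof
    fix x assume x: "x \<in> p \<inter> \<int>"
    then obtain j where j: "x = of_int j"
      by (auto elim: Ints_cases)
    with x dvd have "l dvd j" by blast
    with j show "x \<in> {of_int (l * k) | k. True}"
      by (auto elim: dvdE)
  qed
  moreover have "{of_int (l * k) | k. True} \<subseteq> p \<inter> \<int>"
    using mult by (auto simp del: of_int_mult)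
  ultimately show ?thesis
    unfolding lies_over_def by blast
qed

section \<open>Doubling the point on the Legendre curve\<close>

lemma legendre_smooth:
  fixes lam :: "'a::field_char_0"
  assumes "lam \<noteq> 0" "lam \<noteq> 1" "x ^ 3 + (1 + lam) * x\<^sup>2 + lam * x + 0 = 0"
  shows "3 * x\<^sup>2 + 2 * (1 + lam) * x + lam \<noteq> 0"
proof -
  have "x * ((x + 1) * (x + lam)) = 0"
    using assms(3) by (simp add: algebra_simps power2_eq_square power3_eq_cube)
  then consider "x = 0" | "x = - 1" | "x = - lam"
    by (auto simp: add_eq_0_iff2)
  thus ?thesis
  proof cases
    case 3
    have "3 * x\<^sup>2 + 2 * (1 + lam) * x + lam = lam * (lam - 1)"
      unfolding 3 by (simp add: algebra_simps power2_eq_square)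
    thus ?thesis using assms by simp
  qed (use assms in \<open>simp_all add: algebra_simps\<close>)
qed

text \<open>On this curve x(2 P) = ((x^2 - lam) / (2 y))^2. Eliminating \<open>lam\<close> gives x^2
  - lam = u (u + 1) (1 - r^2), whose factor u (u + 1) cancels against y. The factor
  \<open>\<eta>\<close> collects what is left in y(2 P) and is congruent to 1 modulo r^2.\<close>

lemma double_legendre_point:
  fixes u r lam :: "'a::field_char_0"
  assumes u: "u \<noteq> 0" "u \<noteq> - 1" "r \<noteq> 0" and lam: "u + lam = u * (u + 1) * r\<^sup>2"
  defines "\<eta> \<equiv> (1 + r\<^sup>2 * (2 * u + 1)) * (1 - r\<^sup>2) - 4 * u * r\<^sup>2"
  shows "point_add (legendre lam) (Affine u (u * (u + 1) * r)) (Affine u (u * (u + 1) * r))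
    = Affine (((1 - r\<^sup>2) / (2 * r))\<^sup>2) (- ((1 - r\<^sup>2) * \<eta> / (8 * r ^ 3)))"
proof -
  have "u + 1 \<noteq> 0"
    using u(2) by (simp add: add_eq_0_iff2)
  define y where "y = u * (u + 1) * r"
  have y: "y \<noteq> 0"
    using u \<open>u + 1 \<noteq> 0\<close> by (simp add: y_def)
  have lam': "lam = u * (u + 1) * r\<^sup>2 - u"
    using lam by (simp add: eq_diff_eq add.commute)
  define l where "l = (1 + r\<^sup>2 * (2 * u + 1)) / (2 * r)"
  have num: "3 * u\<^sup>2 + 2 * (1 + lam) * u + lam = u * (u + 1) * (1 + r\<^sup>2 * (2 * u + 1))"
    unfolding lam' by (simp add: algebra_simps power2_eq_square)
  have slope: "(3 * u\<^sup>2 + 2 * (1 + lam) * u + lam) / (2 * y) = l"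
  proof -
    have "(v * t) / (2 * (v * r)) = t / (2 * r)" if "v \<noteq> 0" for v t :: 'a
      using that by simp
    thus ?thesis
      unfolding num y_def l_def using u(1) \<open>u + 1 \<noteq> 0\<close> by simp
  qed
  have x3: "l\<^sup>2 - (1 + lam) - u - u = ((1 - r\<^sup>2) / (2 * r))\<^sup>2"
  proof -
    have "4 * r\<^sup>2 * (l\<^sup>2 - (1 + lam) - u - u) = (1 + r\<^sup>2 * (2 * u + 1))\<^sup>2 - 4 * r\<^sup>2 * (1 + lam + u + u)"
      unfolding l_def using u(3) by (simp add: power_divide power_mult_distrib algebra_simps)
    also have "\<dots> = (1 - r\<^sup>2)\<^sup>2"
      unfolding lam' by (simp add: algebra_simps power2_eq_square)
    finally show ?thesis
      using u(3) by (simp add: power_divide power_mult_distrib field_simps)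
  qed
  have y3: "- (l * ((1 - r\<^sup>2) / (2 * r))\<^sup>2) - (y - l * u) = - ((1 - r\<^sup>2) * \<eta> / (8 * r ^ 3))"
  proof -
    have "y - l * u = (2 * r * y - (1 + r\<^sup>2 * (2 * u + 1)) * u) / (2 * r)"
      unfolding l_def using u(3) by (simp add: field_simps)
    also have "\<dots> = - (u * (1 - r\<^sup>2)) / (2 * r)"
      unfolding y_def by (simp add: algebra_simps power2_eq_square)
    also have "\<dots> = - (4 * u * r\<^sup>2 * (1 - r\<^sup>2)) / (8 * r ^ 3)"
      using u(3) by (simp add: field_simps power2_eq_square power3_eq_cube)
    finally have 1: "y - l * u = - (4 * u * r\<^sup>2 * (1 - r\<^sup>2)) / (8 * r ^ 3)" .
    have 2: "l * ((1 - r\<^sup>2) / (2 * r))\<^sup>2 = (1 + r\<^sup>2 * (2 * u + 1)) * (1 - r\<^sup>2) * (1 - r\<^sup>2) / (8 * r ^ 3)"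
      unfolding l_def by (simp add: power2_eq_square power3_eq_cube mult.assoc)
    show ?thesis
    proof -
      have "- (s / d) - - t / d = - ((s - t) / d)" for s t d :: 'a
        by (simp add: diff_divide_distrib)
      moreover have "(1 + r\<^sup>2 * (2 * u + 1)) * (1 - r\<^sup>2) * (1 - r\<^sup>2) - 4 * u * r\<^sup>2 * (1 - r\<^sup>2) = (1 - r\<^sup>2) * \<eta>"
        by (simp add: \<eta>_def algebra_simps)
      ultimately show ?thesis
        unfolding 1 2 by (simp only:)
    qed
  qed
  have "y + y \<noteq> 0"
    using y by (simp flip: mult_2)
  thus ?thesis
    using slope x3 y3 by (simp add: legendre_def Let_def flip: y_def)
qed

text \<open>The double has z = - 2 r (1 - r^2) / \<eta> and 1 / y = - 8 r^3 / ((1 - r^2) \<eta>). If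
  r lies in a prime, then 1 - r^2 and \<eta> are units there and both values lie in the maximal
  ideal.\<close>

lemma infinite_order_legendre_point:
  fixes u r lam :: "'a::field_char_0"
  assumes lam: "lam \<noteq> 0" "lam \<noteq> 1" "u + lam = u * (u + 1) * r\<^sup>2"
    and u: "u \<noteq> 0" "u \<noteq> - 1" "r \<noteq> 0" "u \<in> ring_of_integers L"
    and p: "prime_of L p" "r \<in> p" and q: "prime_of L q" "r \<in> q" and pq: "p \<inter> \<int> \<noteq> q \<inter> \<int>"
    and k: "(k::nat) > 0"
  shows "Affine u (u * (u + 1) * r) [^]\<^bsub>point_group (legendre lam) UNIV\<^esub> k \<noteq> Infinity"
proof
  define P where "P = Affine u (u * (u + 1) * r)"
  let ?W = "Weierstrass 0 (1 + lam) 0 lam 0"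
  let ?E = "point_group ?W UNIV"
  assume "Affine u (u * (u + 1) * r) [^]\<^bsub>point_group (legendre lam) UNIV\<^esub> k = Infinity"
  hence Pk: "P [^]\<^bsub>?E\<^esub> k = Infinity"
    by (simp add: P_def legendre_def)
  have mon: "monoid ?E"
    by (rule monoid_point_group[OF legendre_smooth[OF lam(1,2)]])
  interpret monoid ?E by fact
  have lam': "lam = u * (u + 1) * r\<^sup>2 - u"
    using lam(3) by (simp add: eq_diff_eq add.commute)
  have "on_curve ?W P"
    unfolding P_def lam' by (simp add: algebra_simps power2_eq_square power3_eq_cube)
  hence P: "P \<in> carrier ?E"
    by (simp add: point_group_def rational_points_def)
  define Q where "Q = point_add ?W P P"
  have Q_pow: "Q = P [^]\<^bsub>?E\<^esub> (2::nat)"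
    using P by (simp add: numeral_2_eq_2 Q_def) (simp add: point_group_def)
  have "on_curve ?W Q"
    using \<open>on_curve ?W P\<close> by (simp add: Q_def on_curve_point_add)
  define \<eta> where "\<eta> = (1 + r\<^sup>2 * (2 * u + 1)) * (1 - r\<^sup>2) - 4 * u * r\<^sup>2"
  have Q: "Q = Affine (((1 - r\<^sup>2) / (2 * r))\<^sup>2) (- ((1 - r\<^sup>2) * \<eta> / (8 * r ^ 3)))"
    using double_legendre_point[OF u(1-3) lam(3)] by (simp add: Q_def P_def \<eta>_def legendre_def)
  have red: "formal_group (local_ring L p) (local_max L p) (1 + lam) lam \<and>
      formal_group.reduces_to_infinity (local_max L p) Q"
    if p: "prime_of L p" "r \<in> p" for p
  proof -
    interpret local_subring "local_ring L p" "local_max L p"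
      by (rule local_subring_local_ring[OF p(1)])
    have A: "u \<in> local_ring L p" "r \<in> local_ring L p" and r: "r \<in> local_max L p"
      using integers_local_ring[OF p(1)] p(2) u(4) I_subset by blast+
    have lamA: "lam \<in> local_ring L p"
      unfolding lam' by (intro A_intros A)
    interpret formal_group "local_ring L p" "local_max L p" "1 + lam" lam
      by unfold_locales (intro A_intros lamA)+
    have r2: "1 - r\<^sup>2 \<noteq> 0" "inverse (1 - r\<^sup>2) \<in> local_ring L p"
      by (rule one_minus_unit, intro I_power r; simp)+
    have "\<eta> = 1 - (r\<^sup>2 + r\<^sup>2 * (4 * u) - r\<^sup>2 * (2 * u + 1) * (1 - r\<^sup>2))"
      by (simp add: \<eta>_def algebra_simps)
    moreover have "r\<^sup>2 + r\<^sup>2 * (4 * u) - r\<^sup>2 * (2 * u + 1) * (1 - r\<^sup>2) \<in> local_max L p"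
      using A r by (intro I_diff I_add I_mult_right I_power A_intros; simp)
    ultimately have \<eta>: "\<eta> \<noteq> 0" "inverse \<eta> \<in> local_ring L p"
      using one_minus_unit by simp_all
    have "((1 - r\<^sup>2) / (2 * r))\<^sup>2 / (- ((1 - r\<^sup>2) * \<eta> / (8 * r ^ 3))) = - (r * (2 * (1 - r\<^sup>2)) * inverse \<eta>)"
      using r2(1) \<eta>(1) u(3) by (simp add: field_simps power2_eq_square power3_eq_cube)
    moreover have "\<dots> \<in> local_max L p"
      using r \<eta> A by (intro I_minus I_mult_right A_intros; simp)
    moreover have "1 / (- ((1 - r\<^sup>2) * \<eta> / (8 * r ^ 3))) = - (r * (8 * r\<^sup>2) * inverse (1 - r\<^sup>2) * inverse \<eta>)"
      using r2(1) \<eta>(1) u(3) by (simp add: field_simps power2_eq_square power3_eq_cube)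
    moreover have "\<dots> \<in> local_max L p"
      using r \<eta> r2 A by (intro I_minus I_mult_right A_intros; simp)
    moreover have "- ((1 - r\<^sup>2) * \<eta> / (8 * r ^ 3)) \<noteq> 0"
      using r2(1) \<eta>(1) u(3) by simp
    ultimately have "reduces_to_infinity Q"
      unfolding Q reduces_to_infinity.simps by simp
    thus ?thesis
      using formal_group_axioms by blast
  qed
  have unit: "\<exists>v. of_nat l * v = 1 \<and> (v \<in> local_ring L p \<or> v \<in> local_ring L q)" if l: "prime (l::nat)" for l
  proof -
    \<comment> \<open>A rational prime lying in both p and q would generate both contractions to the
      integers, making them equal.\<close>
    have "\<not> (of_nat l \<in> p \<and> of_nat l \<in> q)"
      using of_int_in_prime_imp_lies_over[OF p(1), of "int l"] of_int_in_prime_imp_lies_over[OF q(1), of "int l"]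
        l pq by (auto simp: lies_over_def)
    moreover have "inverse (of_nat l) \<in> local_ring L s" if s: "prime_of L s" "of_nat l \<notin> s" for s
    proof -
      have "of_nat j \<in> ring_of_integers L" for j
        using prime_ofD(1,2,6)[OF s(1)] prime_ofD(5)[OF s(1) prime_ofD(6)[OF s(1)]] by (induction j) simp_all
      hence "1 / of_nat l \<in> local_ring L s"
        unfolding local_ring_def using s(2) prime_ofD(1)[OF s(1)] by blast
      thus ?thesis
        by (simp add: inverse_eq_divide)
    qed
    moreover have "of_nat l * inverse (of_nat l) = (1 :: 'a)"
      using prime_gt_0_nat[OF l] by simp
    ultimately show ?thesis
      using p q by blast
  qed
  have "Q [^]\<^bsub>?E\<^esub> k = (P [^]\<^bsub>?E\<^esub> k) [^]\<^bsub>?E\<^esub> (2::nat)"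
    unfolding Q_pow using P by (simp add: nat_pow_pow mult.commute)
  hence "Q [^]\<^bsub>?E\<^esub> k = Infinity"
    unfolding Pk using nat_pow_one[of 2] by (simp add: point_group_def)
  hence "Q = Infinity"
    using no_torsion_of_two_primes[OF _ _ mon unit \<open>on_curve ?W Q\<close>] red[OF p] red[OF q] k by blast
  thus False
    by (simp add: Q)
qed

section \<open>Power sums and normal extensions\<close>

lemma subring_KbarD:
  fixes S :: "'a::field_char_0 set"
  assumes "subring S Kbar"
  shows "0 \<in> S" "1 \<in> S" "x \<in> S \<Longrightarrow> y \<in> S \<Longrightarrow> x + y \<in> S" "x \<in> S \<Longrightarrow> y \<in> S \<Longrightarrow> x * y \<in> S" "x \<in> S \<Longrightarrow> - x \<in> S"
proof -
  interpret Kbar: field "Kbar :: 'a ring"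
    by (rule field_from_type_algebra)
  show "0 \<in> S" "1 \<in> S" "x \<in> S \<Longrightarrow> y \<in> S \<Longrightarrow> x + y \<in> S" "x \<in> S \<Longrightarrow> y \<in> S \<Longrightarrow> x * y \<in> S"
    using subringE(2,3)[OF assms] subringE(6,7)[OF assms, of x y] by simp_all
  show "- x \<in> S" if "x \<in> S"
  proof -
    have "x + a_inv Kbar x = 0"
      using Kbar.r_neg[of x] by simp
    from group_add_class.minus_unique[OF this] show ?thesis
      using subringE(5)[OF assms that] by simp
  qed
qed

lemma subring_KbarI:
  fixes S :: "'a::field_char_0 set"
  assumes "1 \<in> S" "\<And>x y. x \<in> S \<Longrightarrow> y \<in> S \<Longrightarrow> x + y \<in> S" "\<And>x y. x \<in> S \<Longrightarrow> y \<in> S \<Longrightarrow> x * y \<in> S" "\<And>x. x \<in> S \<Longrightarrow> - x \<in> S"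
  shows "subring S Kbar"
proof -
  interpret Kbar: field "Kbar :: 'a ring"
    by (rule field_from_type_algebra)
  have "a_inv Kbar x = - x" for x :: 'a
  proof -
    have "x + a_inv Kbar x = 0"
      using Kbar.r_neg[of x] by simp
    from group_add_class.minus_unique[OF this] show ?thesis by simp
  qed
  thus ?thesis
    by (intro Kbar.subringI) (simp_all add: assms)
qed

lemma subfield_KbarD:
  fixes S :: "'a::field_char_0 set"
  assumes "subfield S Kbar"
  shows "subring S Kbar" "x \<in> S \<Longrightarrow> inverse x \<in> S"
proof -
  interpret Kbar: field "Kbar :: 'a ring"
    by (rule field_from_type_algebra)
  show S: "subring S Kbar"
    using assms by (rule subfieldE)
  show "inverse x \<in> S" if "x \<in> S"
  proof (cases "x = 0")
    case False
    have "m_inv Kbar x \<in> S" "x * m_inv Kbar x = 1"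
      using Kbar.subfield_m_inv[OF assms, of x] False that by simp_all
    thus ?thesis
      by (metis inverse_unique)
  qed (use subring_KbarD[OF S] in simp)
qed

lemma Kbar_nat_pow: "x [^]\<^bsub>Kbar\<^esub> (n::nat) = x ^ n"
  by (induction n) (simp_all add: nat_pow_def ring_of_type_algebra_def)

text \<open>Polynomials over the ring record are coefficient lists with the leading coefficient
  first, hence the reversal.\<close>

lemma Kbar_eval: "ring.eval Kbar l x = poly (Poly (rev l)) x"
proof -
  interpret Kbar: field "Kbar :: 'a ring"
    by (rule field_from_type_algebra)
  show ?thesis
  proof (induction l)
    case (Cons k l)
    thus ?case
      by (simp add: Kbar_nat_pow Poly_snoc poly_monom mult.commute)
  qed simp
qed

lemma rev_coeffs_in_univ_poly:
  assumes "subring S (Kbar :: 'a::field_char_0 ring)" "\<And>i. coeff p i \<in> S"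
  shows "rev (coeffs p) \<in> carrier (univ_poly Kbar S)"
proof -
  have "set (rev (coeffs p)) \<subseteq> S"
    using assms(2) by (auto simp: coeffs_def)
  moreover have "hd (rev (coeffs p)) \<noteq> 0" if "rev (coeffs p) \<noteq> []"
    using that by (simp add: hd_rev last_coeffs_eq_coeff_degree)
  ultimately show ?thesis
    unfolding univ_poly_def polynomial_def by auto
qed

lemma Kbar_eval_rev_coeffs: "ring.eval Kbar (rev (coeffs p)) x = poly p x"
  by (simp add: Kbar_eval)

lemma root_ex_algebraic_closure:
  fixes p :: "'a::field_char_0 poly"
  assumes "algebraic_closure (Kbar :: 'a ring) K" and deg: "Polynomial.degree p > 0"
  shows "\<exists>x. poly p x = 0"
proof -
  interpret algebraic_closure "Kbar :: 'a ring" K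
    by fact
  let ?l = "rev (coeffs p)"
  have p: "?l \<in> carrier (poly_ring Kbar)"
    by (intro rev_coeffs_in_univ_poly) (use carrier_is_subring in simp_all)
  have "size (roots ?l) = length ?l - 1"
    using roots_over_carrier[OF p] unfolding splitted_def .
  also have "\<dots> = Polynomial.degree p"
    by (simp add: degree_eq_length_coeffs)
  finally obtain x where "x \<in># roots ?l"
    using deg by (metis size_empty multiset_nonemptyE less_numeral_extra(3))
  hence "eval ?l x = 0"
    using roots_mem_iff_is_root[OF p] by (simp add: is_root_def)
  thus ?thesis
    by (auto simp: Kbar_eval_rev_coeffs)
qed

lemma monic_splits:
  fixes p :: "'a::field poly"
  assumes "\<And>p :: 'a poly. Polynomial.degree p > 0 \<Longrightarrow> \<exists>x. poly p x = 0" and "lead_coeff p = 1"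
  shows "\<exists>xs. p = (\<Prod>x\<leftarrow>xs. [:- x, 1:])"
  using assms(2)
proof (induction "Polynomial.degree p" arbitrary: p)
  case 0
  hence "p = 1"
    by (metis degree_eq_zeroE lead_coeff_pCons(2) one_pCons)
  thus ?case
    by (intro exI[of _ "[]"]) simp
next
  case (Suc n)
  then obtain x where "poly p x = 0"
    using assms(1)[of p] by auto
  then obtain q where q: "p = [:- x, 1:] * q"
    by (metis dvdE poly_eq_0_iff_dvd)
  have "q \<noteq> 0"
    using Suc.prems q by auto
  hence "Polynomial.degree p = Suc (Polynomial.degree q)"
    unfolding q by (subst degree_mult_eq) auto
  moreover have "lead_coeff q = 1"
    using Suc.prems unfolding q lead_coeff_mult by simp
  ultimately obtain xs where "q = (\<Prod>x\<leftarrow>xs. [:- x, 1:])"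
    using Suc.hyps(1)[of q] Suc.hyps(2) by auto
  with q show ?case
    by (intro exI[of _ "x # xs"]) simp
qed

section \<open>Newton's identities\<close>

abbreviation power_sum :: "'a::comm_semiring_1 list \<Rightarrow> nat \<Rightarrow> 'a" where
  "power_sum xs k \<equiv> (\<Sum>x\<leftarrow>xs. x ^ k)"

text \<open>This is the logarithmic derivative of the product: a factor 1 - x X contributes - x / (1
  - x X), a geometric series with coefficients - x^(k+1).\<close>

lemma newton_fps:
  fixes xs :: "'a::field list"
  defines "P \<equiv> \<Prod>x\<leftarrow>xs. 1 - fps_const x * fps_X"
  shows "fps_deriv P = - P * Abs_fps (\<lambda>k. power_sum xs (Suc k))"
  unfolding P_def
proof (induction xs)
  case Nil
  show ?case
    by (simp add: fps_eq_iff)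
next
  case (Cons x xs)
  let ?P = "\<Prod>x\<leftarrow>xs. 1 - fps_const x * fps_X" and ?S = "Abs_fps (\<lambda>k. power_sum xs (Suc k))"
  let ?G = "Abs_fps (\<lambda>k. x ^ Suc k)"
  have G: "(1 - fps_const x * fps_X) * ?G = fps_const x"
  proof (rule fps_ext)
    fix k
    show "((1 - fps_const x * fps_X) * ?G) $ k = fps_const x $ k"
      by (cases k) (simp_all add: left_diff_distrib mult.assoc)
  qed
  have S: "Abs_fps (\<lambda>k. power_sum (x # xs) (Suc k)) = ?G + ?S"
    by (simp add: fps_eq_iff)
  have "fps_deriv (\<Prod>x\<leftarrow>x # xs. 1 - fps_const x * fps_X)
      = - (fps_const x * ?P) + (1 - fps_const x * fps_X) * (- ?P * ?S)"
    by (simp add: Cons.IH flip: fps_const_neg)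
  also have "\<dots> = - ((1 - fps_const x * fps_X) * ?P) * (?G + ?S)"
    by (subst (1) G[symmetric]) (simp add: algebra_simps)
  finally show ?case
    unfolding S by (simp only: list.map prod_list.Cons)
qed

lemma newton_recursion:
  fixes xs :: "'a::field list"
  defines "P \<equiv> \<Prod>x\<leftarrow>xs. 1 - fps_const x * fps_X"
  shows "of_nat (Suc k) * P $ Suc k = - (\<Sum>i\<le>k. P $ i * power_sum xs (Suc (k - i)))"
proof -
  have "of_nat (Suc k) * P $ Suc k = fps_deriv P $ k"
    by simp
  also have "\<dots> = - (\<Sum>i\<le>k. P $ i * power_sum xs (Suc (k - i)))"
    unfolding P_def newton_fps by (simp add: fps_mult_nth atLeast0AtMost)
  finally show ?thesis .
qed

lemma sum_in_subring:
  assumes "subring S Kbar" "\<And>i. i \<in> A \<Longrightarrow> f i \<in> S"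
  shows "sum f A \<in> S"
  using assms(2) by (induction A rule: infinite_finite_induct) (auto intro: subring_KbarD[OF assms(1)])

lemma of_nat_in_subring:
  assumes "subring S Kbar"
  shows "of_nat n \<in> S"
  by (induction n) (auto intro: subring_KbarD[OF assms])

lemma power_in_subring:
  assumes "subring S Kbar" "x \<in> S"
  shows "x ^ n \<in> S"
  using assms(2) by (induction n) (auto intro: subring_KbarD[OF assms(1)])

lemma fps_prod_list_0: "(\<Prod>x\<leftarrow>xs. 1 - fps_const x * fps_X) $ 0 = (1 :: 'a::field)"
  by (induction xs) simp_all

text \<open>The recursion yields (k + 1) times the next coefficient. Dividing by k + 1 uses
  characteristic 0 and a subfield, whereas the converse below stays within a subring.\<close>

lemma power_sums_imp_coeffs:
  fixes xs :: "'a::field_char_0 list"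
  assumes "subfield S Kbar" "\<And>k. power_sum xs k \<in> S"
  shows "(\<Prod>x\<leftarrow>xs. 1 - fps_const x * fps_X) $ k \<in> S" (is "?P $ k \<in> S")
proof (induction k rule: less_induct)
  case (less k)
  note S = subfield_KbarD(1)[OF assms(1)]
  show ?case
  proof (cases k)
    case 0
    thus ?thesis
      using subring_KbarD(2)[OF S] by (simp add: fps_prod_list_0)
  next
    case (Suc j)
    have "- (\<Sum>i\<le>j. ?P $ i * power_sum xs (Suc (j - i))) \<in> S"
      using less.IH Suc assms(2) by (intro subring_KbarD[OF S] sum_in_subring[OF S]) (auto simp del: power_Suc)
    hence "of_nat (Suc j) * ?P $ Suc j \<in> S"
      unfolding newton_recursion .
    moreover have "inverse (of_nat (Suc j)) \<in> S"
      by (intro subfield_KbarD(2)[OF assms(1)] of_nat_in_subring[OF S])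
    ultimately have "inverse (of_nat (Suc j)) * (of_nat (Suc j) * ?P $ Suc j) \<in> S"
      by (rule subring_KbarD(4)[OF S, rotated])
    moreover have "inverse (of_nat (Suc j)) * (of_nat (Suc j) * t) = t" for t :: 'a
      by (metis left_inverse mult.assoc mult_1 of_nat_neq_0)
    ultimately show ?thesis
      by (simp only: Suc)
  qed
qed

lemma coeffs_imp_power_sums:
  fixes xs :: "'a::field_char_0 list"
  assumes "subring S Kbar" "\<And>k. (\<Prod>x\<leftarrow>xs. 1 - fps_const x * fps_X) $ k \<in> S" (is "\<And>k. ?P $ k \<in> S")
  shows "power_sum xs k \<in> S"
proof (induction k rule: less_induct)
  case (less k)
  show ?case
  proof (cases k)
    case 0
    have "power_sum xs 0 = of_nat (length xs)"
      by (induction xs) simp_all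
    thus ?thesis
      using of_nat_in_subring[OF assms(1)] 0 by simp
  next
    case (Suc j)
    \<comment> \<open>The summand i = 0 has coefficient 1 and is the power sum sought; all other
      power sums have smaller index.\<close>
    have "of_nat (Suc j) * ?P $ Suc j = - power_sum xs (Suc j) - (\<Sum>i<j. ?P $ Suc i * power_sum xs (Suc (j - Suc i)))"
      unfolding newton_recursion
      by (simp add: sum.atMost_shift fps_prod_list_0 del: sum.lessThan_Suc)
    hence "power_sum xs (Suc j) = - (of_nat (Suc j) * ?P $ Suc j + (\<Sum>i<j. ?P $ Suc i * power_sum xs (Suc (j - Suc i))))"
      by (simp add: algebra_simps)
    moreover have "\<dots> \<in> S"
      using less.IH Suc
      by (intro subring_KbarD[OF assms(1)] sum_in_subring[OF assms(1)] of_nat_in_subring[OF assms(1)] assms(2)) (auto simp del: power_Suc)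
    ultimately show ?thesis
      unfolding Suc by simp
  qed
qed

text \<open>Newton's recursion speaks of the factors 1 - x X, normality of the factors X - x; these
  are reversals of each other, so the coefficients agree in opposite order.\<close>

lemma fps_of_poly_prod_reflect:
  "(\<Prod>x\<leftarrow>xs. 1 - fps_const x * fps_X) = fps_of_poly (reflect_poly (\<Prod>x\<leftarrow>xs. [:- x, 1 :: 'a::field:]))"
proof (induction xs)
  case (Cons x xs)
  have "reflect_poly [:- x, 1:] = [:1, - x:]"
    by (simp add: reflect_poly_def coeffs_def)
  hence "1 - fps_const x * fps_X = fps_of_poly (reflect_poly [:- x, 1:])"
    by (simp add: fps_of_poly_pCons mult.commute flip: fps_const_neg)
  thus ?case
    by (simp only: list.map prod_list.Cons reflect_poly_mult fps_of_poly_mult Cons.IH)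
qed simp

lemma coeff_prod_list_in_iff:
  fixes xs :: "'a::field list" and S
  defines "g \<equiv> \<Prod>x\<leftarrow>xs. [:- x, 1:]"
  assumes "0 \<in> S"
  shows "(\<forall>k. (\<Prod>x\<leftarrow>xs. 1 - fps_const x * fps_X) $ k \<in> S) \<longleftrightarrow> (\<forall>k. coeff g k \<in> S)"
proof -
  have P: "(\<Prod>x\<leftarrow>xs. 1 - fps_const x * fps_X) $ k = (if k > Polynomial.degree g then 0 else coeff g (Polynomial.degree g - k))" for k
    unfolding fps_of_poly_prod_reflect by (simp add: g_def coeff_reflect_poly)
  show ?thesis
    unfolding P using assms(2)
    by (metis coeff_eq_0 diff_diff_cancel diff_le_self linorder_not_less)
qed

section \<open>Lists with power sums in the base field, and normality\<close>

lemma sum_list_product: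
  fixes f :: "'b \<Rightarrow> 'a::comm_semiring_1"
  shows "(\<Sum>(x, y)\<leftarrow>List.product xs ys. f x * g y) = (\<Sum>x\<leftarrow>xs. f x) * (\<Sum>y\<leftarrow>ys. g y)"
  by (induction xs) (simp_all add: sum_list_const_mult distrib_right comp_def)

lemma sum_list_sum_swap: "(\<Sum>z\<leftarrow>zs. \<Sum>i\<in>A. h z i) = (\<Sum>i\<in>A. \<Sum>z\<leftarrow>zs. h z i)"
  by (induction zs) (simp_all add: sum.distrib)

text \<open>The lists \<open>xs\<close> below play the role of full sets of conjugates over \<open>K\<close>.\<close>

definition conjugates_in :: "'a::field_char_0 set \<Rightarrow> 'a set \<Rightarrow> 'a set" where
  "conjugates_in K F = {x. \<exists>xs. x \<in> set xs \<and> set xs \<subseteq> F \<and> (\<forall>k. power_sum xs k \<in> K)}"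

lemma subring_conjugates_in:
  assumes K: "subring K Kbar" and F: "subring F Kbar" and "K \<subseteq> F"
  shows "K \<subseteq> conjugates_in K F" "subring (conjugates_in K F) Kbar"
proof -
  show sub: "K \<subseteq> conjugates_in K F"
  proof
    fix x assume "x \<in> K"
    thus "x \<in> conjugates_in K F"
      unfolding conjugates_in_def using assms(3) power_in_subring[OF K]
      by (intro CollectI exI[of _ "[x]"]) auto
  qed
  have mult: "x * y \<in> conjugates_in K F" and add: "x + y \<in> conjugates_in K F"
    if x: "x \<in> conjugates_in K F" and y: "y \<in> conjugates_in K F" for x y
  proof -
    obtain xs where xs: "x \<in> set xs" "set xs \<subseteq> F" "\<And>k. power_sum xs k \<in> K"
      using x unfolding conjugates_in_def by auto
    obtain ys where ys: "y \<in> set ys" "set ys \<subseteq> F" "\<And>k. power_sum ys k \<in> K"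
      using y unfolding conjugates_in_def by auto
    let ?zs = "map (\<lambda>(x, y). x * y) (List.product xs ys)"
    have "power_sum ?zs k = (\<Sum>(x, y)\<leftarrow>List.product xs ys. x ^ k * y ^ k)" for k
      by (simp add: comp_def case_prod_unfold power_mult_distrib)
    hence "power_sum ?zs k \<in> K" for k
      unfolding sum_list_product using xs(3) ys(3) by (simp add: subring_KbarD[OF K])
    moreover have "x * y \<in> set ?zs" "set ?zs \<subseteq> F"
      using xs ys by (auto intro: subring_KbarD[OF F])
    ultimately show "x * y \<in> conjugates_in K F"
      unfolding conjugates_in_def by blast
    let ?zs = "map (\<lambda>(x, y). x + y) (List.product xs ys)"
    have "power_sum ?zs k \<in> K" for k
    proof -
      have "power_sum ?zs k = (\<Sum>z\<leftarrow>List.product xs ys. \<Sum>i\<le>k. of_nat (k choose i) * fst z ^ i * snd z ^ (k - i))"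
        by (simp add: comp_def case_prod_unfold binomial_ring)
      also have "\<dots> = (\<Sum>i\<le>k. \<Sum>(x, y)\<leftarrow>List.product xs ys. (of_nat (k choose i) * x ^ i) * y ^ (k - i))"
        unfolding case_prod_unfold by (rule sum_list_sum_swap)
      also have "\<dots> = (\<Sum>i\<le>k. of_nat (k choose i) * power_sum xs i * power_sum ys (k - i))"
        unfolding sum_list_product by (simp add: sum_list_const_mult)
      also have "\<dots> \<in> K"
        by (intro sum_in_subring[OF K] subring_KbarD[OF K] of_nat_in_subring[OF K] xs ys)
      finally show ?thesis .
    qed
    moreover have "x + y \<in> set ?zs" "set ?zs \<subseteq> F"
      using xs ys by (auto intro: subring_KbarD[OF F])
    ultimately show "x + y \<in> conjugates_in K F"
      unfolding conjugates_in_def by blast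
  qed
  have "- x \<in> conjugates_in K F" if "x \<in> conjugates_in K F" for x
  proof -
    have "- 1 \<in> conjugates_in K F"
      using sub subring_KbarD(2,5)[OF K] by blast
    from mult[OF this that] show ?thesis by simp
  qed
  thus "subring (conjugates_in K F) Kbar"
    using subring_KbarD[OF K] sub mult add by (intro subring_KbarI) auto
qed

text \<open>By Newton's identities the product of X - z over the list belonging to x has
  coefficients in K. An irreducible f with root x is associated to the minimal polynomial of x,
  which divides this product; so all roots of f are entries of the list.\<close>

lemma normal_ext_conjugates:
  fixes K F :: "'a::field_char_0 set"
  assumes K: "subfield K Kbar" and "F \<subseteq> conjugates_in K F"
    and alg: "\<And>x. (ring.algebraic Kbar over K) x"
  shows "normal_ext K F"
proof -
  interpret Kbar: field "Kbar :: 'a ring"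
    by (rule field_from_type_algebra)
  interpret UP: principal_domain "univ_poly Kbar K"
    using Kbar.univ_poly_is_principal[OF K] .
  show ?thesis
    unfolding normal_ext_def
  proof (intro ballI impI allI, elim conjE bexE)
    fix f x y
    assume f: "f \<in> carrier (univ_poly Kbar K)" "pirreducible\<^bsub>Kbar\<^esub> K f"
      and x: "x \<in> F" "ring.eval Kbar f x = 0" and y: "ring.eval Kbar f y = 0"
    obtain xs where xs: "x \<in> set xs" "set xs \<subseteq> F" "\<And>k. power_sum xs k \<in> K"
      using x(1) assms(2) unfolding conjugates_in_def by auto
    define g where "g = (\<Prod>x\<leftarrow>xs. [:- x, 1:])"
    have "\<forall>k. poly.coeff g k \<in> K"
      unfolding g_def
      using coeff_prod_list_in_iff[of K xs] power_sums_imp_coeffs[OF K xs(3)] subring_KbarD(1)[OF subfield_KbarD(1)[OF K]]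
      by blast
    hence g: "rev (coeffs g) \<in> carrier (univ_poly Kbar K)"
      by (intro rev_coeffs_in_univ_poly[OF subfield_KbarD(1)[OF K]]) simp
    have root: "poly g z = 0 \<longleftrightarrow> z \<in> set xs" for z
      unfolding g_def by (induction xs) auto
    let ?I = "Kbar.Irr K x"
    have x': "x \<in> carrier Kbar"
      by simp
    note Irr = Kbar.IrrE[OF K x' alg]
    have "f \<in> PIdl\<^bsub>univ_poly Kbar K\<^esub> ?I"
      using f(1) x(2) unfolding Kbar.Irr_generates_ker[OF K x' alg, symmetric] a_kernel_def' by simp
    hence "?I \<sim>\<^bsub>univ_poly Kbar K\<^esub> f"
      by (rule Kbar.cgenideal_pirreducible[OF K Irr(1,2) f(2)])
    hence "f divides\<^bsub>univ_poly Kbar K\<^esub> ?I"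
      by (simp add: associated_def)
    hence "f pdivides\<^bsub>Kbar\<^esub> ?I"
      using Kbar.pdivides_iff_shell[OF K f(1) Irr(1)] by simp
    hence "Kbar.eval ?I y = 0"
      using Kbar.pdivides_imp_root_sharing[OF Kbar.carrier_polynomial_shell[OF subfield_KbarD(1)[OF K] f(1)]] y
      by simp
    moreover have "?I pdivides\<^bsub>Kbar\<^esub> (rev (coeffs g))"
      by (rule Kbar.Irr_minimal[OF K x' alg g]) (use xs(1) root in \<open>simp add: Kbar_eval_rev_coeffs\<close>)
    ultimately have "Kbar.eval (rev (coeffs g)) y = 0"
      using Kbar.pdivides_imp_root_sharing[OF Kbar.carrier_polynomial_shell[OF subfield_KbarD(1)[OF K] Irr(1)]]
      by simp
    thus "y \<in> F"
      using root xs(2) by (auto simp: Kbar_eval_rev_coeffs)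
  qed
qed

section \<open>Solvability of the Galois group\<close>

lemma galois_group_simps:
  "carrier (galois_group K M) = {\<sigma> \<in> Bij M. (\<forall>x\<in>M. \<forall>y\<in>M. \<sigma> (x * y) = \<sigma> x * \<sigma> y) \<and>
    (\<forall>x\<in>M. \<forall>y\<in>M. \<sigma> (x + y) = \<sigma> x + \<sigma> y) \<and> \<sigma> 1 = 1 \<and> (\<forall>x\<in>K. \<sigma> x = x)}"
  "\<sigma> \<in> Bij M \<Longrightarrow> \<tau> \<in> Bij M \<Longrightarrow> \<sigma> \<otimes>\<^bsub>galois_group K M\<^esub> \<tau> = compose M \<sigma> \<tau>"
  "\<one>\<^bsub>galois_group K M\<^esub> = (\<lambda>x\<in>M. x)"
  unfolding galois_group_def BijGroup_def ring_hom_def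
  by (auto dest: Bij_imp_funcset)

lemma group_galois_group:
  assumes M: "subring M Kbar" and "K \<subseteq> M"
  shows "group (galois_group K M)"
proof (rule groupI)
  let ?G = "galois_group K M"
  fix \<sigma> \<tau> \<rho>
  assume \<sigma>: "\<sigma> \<in> carrier ?G"
  hence \<sigma>B: "\<sigma> \<in> Bij M" and \<sigma>M: "\<And>x. x \<in> M \<Longrightarrow> \<sigma> x \<in> M"
    using Bij_imp_funcset[of \<sigma> M] by (auto simp: galois_group_simps)
  show "\<one>\<^bsub>?G\<^esub> \<otimes>\<^bsub>?G\<^esub> \<sigma> = \<sigma>"
    using \<sigma>B Bij_imp_extensional[OF \<sigma>B] Bij_imp_funcset[OF \<sigma>B]
    by (simp add: galois_group_simps id_Bij)
  show "\<exists>\<upsilon>\<in>carrier ?G. \<upsilon> \<otimes>\<^bsub>?G\<^esub> \<sigma> = \<one>\<^bsub>?G\<^esub>"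
  proof
    let ?\<upsilon> = "\<lambda>x\<in>M. inv_into M \<sigma> x"
    have bij: "bij_betw \<sigma> M M"
      using \<sigma>B by (simp add: Bij_def)
    have inv: "?\<upsilon> (\<sigma> x) = x" if "x \<in> M" for x
      using that \<sigma>M bij by (simp add: bij_betw_inv_into_left)
    have surj: "\<exists>x'\<in>M. x = \<sigma> x'" if "x \<in> M" for x
      using bij that by (auto simp: bij_betw_def)
    have hom: "?\<upsilon> (x * y) = ?\<upsilon> x * ?\<upsilon> y \<and> ?\<upsilon> (x + y) = ?\<upsilon> x + ?\<upsilon> y" if xy: "x \<in> M" "y \<in> M" for x y
    proof -
      obtain x' y' where *: "x' \<in> M" "y' \<in> M" "x = \<sigma> x'" "y = \<sigma> y'"
        using surj xy by blast
      have "x * y = \<sigma> (x' * y')" "x + y = \<sigma> (x' + y')"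
        using \<sigma> * by (auto simp: galois_group_simps)
      thus ?thesis
        using * inv subring_KbarD[OF M] by metis
    qed
    have "?\<upsilon> x = x" if "x \<in> K" for x
      using \<sigma> inv[of x] that assms(2) by (auto simp: galois_group_simps)
    moreover have "?\<upsilon> 1 = 1"
      using \<sigma> inv[of 1] subring_KbarD(2)[OF M] by (auto simp: galois_group_simps)
    ultimately show "?\<upsilon> \<in> carrier ?G"
      using hom restrict_inv_into_Bij[OF \<sigma>B] unfolding galois_group_simps by blast
    show "?\<upsilon> \<otimes>\<^bsub>?G\<^esub> \<sigma> = \<one>\<^bsub>?G\<^esub>"
      by (simp add: galois_group_simps \<sigma>B restrict_inv_into_Bij Bij_compose_restrict_eq)
  qed
  assume \<tau>: "\<tau> \<in> carrier ?G"
  hence \<tau>B: "\<tau> \<in> Bij M" and \<tau>M: "\<And>x. x \<in> M \<Longrightarrow> \<tau> x \<in> M"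
    using Bij_imp_funcset[of \<tau> M] by (auto simp: galois_group_simps)
  show "\<sigma> \<otimes>\<^bsub>?G\<^esub> \<tau> \<in> carrier ?G"
    using \<sigma> \<tau> \<tau>M subring_KbarD[OF M] assms(2) compose_Bij[OF \<sigma>B \<tau>B]
    by (auto simp: galois_group_simps compose_def)
  assume "\<rho> \<in> carrier ?G"
  thus "\<sigma> \<otimes>\<^bsub>?G\<^esub> \<tau> \<otimes>\<^bsub>?G\<^esub> \<rho> = \<sigma> \<otimes>\<^bsub>?G\<^esub> (\<tau> \<otimes>\<^bsub>?G\<^esub> \<rho>)"
    using \<sigma>B \<tau>B compose_assoc[where f = \<rho> and A = M and B = M and g = \<tau> and h = \<sigma>]
    by (simp add: galois_group_simps compose_Bij Bij_imp_funcset)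
next
  show "\<one>\<^bsub>galois_group K M\<^esub> \<in> carrier (galois_group K M)"
    using subring_KbarD[OF M] assms(2) id_Bij by (auto simp: galois_group_simps)
qed

text \<open>A commutator acts on T as the commutator of two commuting permutations, hence trivially.
  Stability keeps the intermediate values in T, where commutation is assumed.\<close>

lemma derived_subset_fixing:
  fixes K M :: "'a::field_char_0 set"
  defines "G \<equiv> galois_group K M"
  assumes M: "subring M Kbar" and "K \<subseteq> M"
    and H: "subgroup H G" and T: "T \<subseteq> M"
    and stable: "\<forall>\<sigma>\<in>H. \<forall>t\<in>T. \<sigma> t \<in> T"
    and comm: "\<forall>\<sigma>\<in>H. \<forall>\<tau>\<in>H. \<forall>t\<in>T. \<sigma> (\<tau> t) = \<tau> (\<sigma> t)"
  shows "subgroup {\<sigma> \<in> H. \<forall>t\<in>T. \<sigma> t = t} G" "derived G H \<subseteq> {\<sigma> \<in> H. \<forall>t\<in>T. \<sigma> t = t}"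
proof -
  interpret group G
    unfolding G_def using group_galois_group[OF M assms(3)] .
  interpret H: subgroup H G by fact
  let ?F = "{\<sigma> \<in> H. \<forall>t\<in>T. \<sigma> t = t}"
  have mult: "(\<sigma> \<otimes>\<^bsub>G\<^esub> \<tau>) t = \<sigma> (\<tau> t)" if "\<sigma> \<in> carrier G" "\<tau> \<in> carrier G" "t \<in> M" for \<sigma> \<tau> t
    using that by (simp add: G_def galois_group_simps compose_def)
  have one: "\<one>\<^bsub>G\<^esub> t = t" if "t \<in> T" for t
    using that T by (auto simp: G_def galois_group_simps)
  have inv1: "(inv\<^bsub>G\<^esub> \<sigma>) (\<sigma> t) = t" and inv2: "\<sigma> ((inv\<^bsub>G\<^esub> \<sigma>) t) = t" if "\<sigma> \<in> H" "t \<in> T" for \<sigma> t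
    using mult[of "inv\<^bsub>G\<^esub> \<sigma>" \<sigma> t] mult[of \<sigma> "inv\<^bsub>G\<^esub> \<sigma>" t] one[of t] that T H.subset by auto
  show F: "subgroup ?F G"
  proof (rule subgroupI)
    show "?F \<subseteq> carrier G"
      using H.subset by auto
    show "?F \<noteq> {}"
      using one H.one_closed by blast
    show "inv\<^bsub>G\<^esub> \<sigma> \<in> ?F" if "\<sigma> \<in> ?F" for \<sigma>
      using that inv1[of \<sigma>] by auto
    show "\<sigma> \<otimes>\<^bsub>G\<^esub> \<tau> \<in> ?F" if "\<sigma> \<in> ?F" "\<tau> \<in> ?F" for \<sigma> \<tau>
      using that T H.subset by (auto simp: mult subset_eq)
  qed
  have "derived_set G H \<subseteq> ?F"
  proof
    fix \<kappa> assume "\<kappa> \<in> derived_set G H"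
    then obtain \<sigma> \<tau> where \<sigma>\<tau>: "\<sigma> \<in> H" "\<tau> \<in> H" and \<kappa>: "\<kappa> = \<sigma> \<otimes>\<^bsub>G\<^esub> \<tau> \<otimes>\<^bsub>G\<^esub> inv\<^bsub>G\<^esub> \<sigma> \<otimes>\<^bsub>G\<^esub> inv\<^bsub>G\<^esub> \<tau>"
      by blast
    have C: "\<sigma> \<in> carrier G" "\<tau> \<in> carrier G"
      using \<sigma>\<tau> H.subset by auto
    have "\<kappa> t = t" if t: "t \<in> T" for t
    proof -
      define t1 where "t1 = (inv\<^bsub>G\<^esub> \<tau>) t"
      define t2 where "t2 = (inv\<^bsub>G\<^esub> \<sigma>) t1"
      have t12: "t1 \<in> T" "t2 \<in> T"
        using \<sigma>\<tau> t stable by (auto simp: t1_def t2_def)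
      have "\<kappa> t = \<sigma> (\<tau> t2)"
        unfolding \<kappa> using C t t12 T by (simp add: mult subset_eq flip: t1_def t2_def)
      also have "\<dots> = \<tau> (\<sigma> t2)"
        using comm \<sigma>\<tau> t12 by blast
      also have "\<dots> = t"
        using inv2[of \<sigma> t1] inv2[of \<tau> t] \<sigma>\<tau> t t12 by (simp add: t1_def t2_def)
      finally show ?thesis .
    qed
    moreover have "\<kappa> \<in> H"
      unfolding \<kappa> using \<sigma>\<tau> by simp
    ultimately show "\<kappa> \<in> ?F" by simp
  qed
  thus "derived G H \<subseteq> ?F"
    unfolding derived_def using F by (rule generate_subgroup_incl)
qed

text \<open>With d the order of z, the powers of z are d distinct roots of X^d - 1, which has no
  others. So a field automorphism sends z to a power of z, and any two automorphisms commute on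
  z.\<close>

lemma root_of_unity_powers:
  fixes z :: "'a::field"
  assumes "n > 0" "z ^ n = 1"
  shows "\<exists>d. z ^ d = 1 \<and> (\<forall>w. w ^ d = 1 \<longrightarrow> (\<exists>j. w = z ^ j))"
proof -
  define d where "d = (LEAST d. d > 0 \<and> z ^ d = 1)"
  have d: "d > 0" "z ^ d = 1"
    using LeastI[of "\<lambda>d. d > 0 \<and> z ^ d = 1" n] assms by (simp_all add: d_def)
  have min: "d \<le> k" if "k > 0" "z ^ k = 1" for k
    using Least_le[of "\<lambda>d. d > 0 \<and> z ^ d = 1" k] that by (simp add: d_def)
  have z: "z \<noteq> 0"
    using assms by (metis power_0_left zero_neq_one gr_implies_not0)
  have no: "z ^ i \<noteq> z ^ j" if "i < j" "j < d" for i j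
  proof
    assume eq: "z ^ i = z ^ j"
    have "z ^ j = z ^ i * z ^ (j - i)"
      using that by (simp flip: power_add)
    hence "z ^ (j - i) = 1"
      using eq z by simp
    thus False
      using min[of "j - i"] that by simp
  qed
  have inj: "inj_on (\<lambda>j. z ^ j) {..<d}"
    by (rule inj_onI) (metis no lessThan_iff linorder_neqE_nat)
  let ?p = "monom 1 d - 1 :: 'a poly"
  have p: "poly ?p w = w ^ d - 1" for w
    by (simp add: poly_monom)
  have "poly ?p 0 \<noteq> 0"
    unfolding p using d(1) by (simp add: power_0_left)
  hence "?p \<noteq> 0"
    by force
  hence "card {w. poly ?p w = 0} \<le> Polynomial.degree ?p" "finite {w. poly ?p w = 0}"
    by (rule card_poly_roots_bound poly_roots_finite)+
  hence "card {w :: 'a. w ^ d = 1} \<le> Polynomial.degree ?p" "finite {w :: 'a. w ^ d = 1}"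
    by (simp_all only: p right_minus_eq)
  moreover have "Polynomial.degree ?p \<le> d"
    by (intro degree_diff_le degree_monom_le) simp
  ultimately have card: "card {w :: 'a. w ^ d = 1} \<le> d" "finite {w :: 'a. w ^ d = 1}"
    by (auto intro: order.trans)
  have "(\<lambda>j. z ^ j) ` {..<d} \<subseteq> {w. w ^ d = 1}"
  proof clarify
    fix j
    have "(z ^ j) ^ d = (z ^ d) ^ j"
      by (simp only: mult.commute flip: power_mult)
    thus "(z ^ j) ^ d = 1"
      by (simp add: d(2))
  qed
  hence "(\<lambda>j. z ^ j) ` {..<d} = {w. w ^ d = 1}"
    using card card_image[OF inj] by (intro card_seteq) auto
  thus ?thesis
    using d(2) by blast
qed

text \<open>Each layer acts abelianly once the earlier ones are fixed: on roots of unity by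
  exponents, on the roots u by multiplication with fixed roots of unity, on the square roots by
  signs. What fixes all three layers fixes generators of M, so the third derived subgroup is
  trivial.\<close>

lemma solvable_galois_group:
  fixes K M :: "'a::field_char_0 set"
  assumes M: "subfield M Kbar" and KM: "K \<subseteq> M"
    and lam: "lam \<in> K" "lam \<noteq> 0" and n: "n > 0"
    and U: "\<And>u. u ^ n = lam \<Longrightarrow> u \<in> M \<and> r u \<in> M \<and> u + 1 \<noteq> 0 \<and> (r u)\<^sup>2 * (u + 1) = u ^ (n - 1) + 1"
    and gen: "\<And>S. subring S Kbar \<Longrightarrow> K \<subseteq> S \<Longrightarrow> {u. u ^ n = lam} \<subseteq> S \<Longrightarrow> r ` {u. u ^ n = lam} \<subseteq> S \<Longrightarrow> M \<subseteq> S"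
  shows "solvable (galois_group K M)"
proof -
  define G where "G = galois_group K M"
  note MR = subfield_KbarD(1)[OF M]
  interpret group G
    unfolding G_def using group_galois_group[OF MR KM] .
  have hom: "\<sigma> (x + y) = \<sigma> x + \<sigma> y" "\<sigma> (x * y) = \<sigma> x * \<sigma> y"
    if "\<sigma> \<in> carrier G" "x \<in> M" "y \<in> M" for \<sigma> x y
    using that by (auto simp: G_def galois_group_simps)
  have in_M: "\<sigma> x \<in> M" if "\<sigma> \<in> carrier G" "x \<in> M" for \<sigma> x
    using that Bij_imp_funcset[of \<sigma> M] by (auto simp: G_def galois_group_simps)
  have fixd: "\<sigma> x = x" "\<sigma> 1 = 1" if "\<sigma> \<in> carrier G" "x \<in> K" for \<sigma> x
    using that by (auto simp: G_def galois_group_simps)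
  have pow: "\<sigma> (x ^ k) = \<sigma> x ^ k" if "\<sigma> \<in> carrier G" "x \<in> M" for \<sigma> x k
    using that fixd(2)[OF that(1) lam(1)] by (induction k) (simp_all add: hom power_in_subring[OF MR])
  have neg: "\<sigma> (- x) = - \<sigma> x" if "\<sigma> \<in> carrier G" "x \<in> M" for \<sigma> x
  proof -
    have "\<sigma> 0 = 0"
      using hom(1)[OF that(1), of 0 0] subring_KbarD(1)[OF MR] by simp
    thus ?thesis
      using hom(1)[OF that, of "- x"] subring_KbarD(5)[OF MR that(2)]
      by (simp add: eq_neg_iff_add_eq_0 add.commute)
  qed
  define T1 where "T1 = {z \<in> M. z ^ n = 1}"
  define T2 where "T2 = {u. u ^ n = lam}"
  \<comment> \<open>Both signs are included, since an automorphism fixing u may send r u to - r u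
    and the set has to be stable.\<close>
  define T3 where "T3 = {s \<in> M. \<exists>u\<in>T2. s\<^sup>2 = (r u)\<^sup>2}"
  have T_subset: "T1 \<subseteq> M" "T2 \<subseteq> M" "T3 \<subseteq> M"
    using U by (auto simp: T1_def T2_def T3_def)
  define A1 where "A1 = {\<sigma> \<in> carrier G. \<forall>t\<in>T1. \<sigma> t = t}"
  define A2 where "A2 = {\<sigma> \<in> A1. \<forall>t\<in>T2. \<sigma> t = t}"
  define A3 where "A3 = {\<sigma> \<in> A2. \<forall>t\<in>T3. \<sigma> t = t}"
  have 1: "subgroup A1 G" "derived G (carrier G) \<subseteq> A1"
  proof -
    have stable: "\<sigma> z \<in> T1" if "\<sigma> \<in> carrier G" "z \<in> T1" for \<sigma> z
    proof -
      have "\<sigma> z ^ n = \<sigma> (z ^ n)"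
        using that pow by (simp add: T1_def)
      thus ?thesis
        using that in_M fixd(2)[OF that(1) lam(1)] by (simp add: T1_def)
    qed
    have comm: "\<sigma> (\<tau> z) = \<tau> (\<sigma> z)" if "\<sigma> \<in> carrier G" "\<tau> \<in> carrier G" "z \<in> T1" for \<sigma> \<tau> z
    proof -
      note in_G = that(1,2)
      have z: "z \<in> M" "z ^ n = 1"
        using that by (simp_all add: T1_def)
      obtain d where d: "z ^ d = 1" "\<And>w. w ^ d = 1 \<Longrightarrow> \<exists>j. w = z ^ j"
        using root_of_unity_powers[OF n z(2)] by blast
      have "\<exists>j. \<upsilon> z = z ^ j" if "\<upsilon> \<in> carrier G" for \<upsilon>
        using pow[OF that z(1), of d] fixd(2)[OF that lam(1)] d by simp
      then obtain i j where ij: "\<sigma> z = z ^ i" "\<tau> z = z ^ j"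
        using in_G by blast
      show ?thesis
        unfolding ij pow[OF that(1) z(1)] pow[OF that(2) z(1)] by (simp add: mult.commute flip: power_mult)
    qed
    show "subgroup A1 G" "derived G (carrier G) \<subseteq> A1"
      using derived_subset_fixing[where H = "carrier G" and T = T1, OF MR KM, folded G_def,
          OF subgroup_self T_subset(1)] stable comm
      by (simp_all add: A1_def)
  qed
  have U': "u \<in> M" "r u \<in> M" "u + 1 \<noteq> 0" "(r u)\<^sup>2 * (u + 1) = u ^ (n - 1) + 1" "u \<noteq> 0" if "u \<in> T2" for u
    using U[of u] that lam(2) n by (auto simp: T2_def)
  have 2: "subgroup A2 G" "derived G A1 \<subseteq> A2"
  proof -
    have stable: "\<sigma> u \<in> T2" if "\<sigma> \<in> A1" "u \<in> T2" for \<sigma> u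
    proof -
      have \<sigma>: "\<sigma> \<in> carrier G"
        using that by (simp add: A1_def)
      have "\<sigma> u ^ n = \<sigma> (u ^ n)"
        using pow[OF \<sigma>] U' that by simp
      thus ?thesis
        using that fixd(1)[OF \<sigma> lam(1)] by (simp add: T2_def)
    qed
    have scale: "\<exists>z\<in>T1. \<sigma> u = z * u" if "\<sigma> \<in> A1" "u \<in> T2" for \<sigma> u
    proof
      have "\<sigma> u \<in> T2"
        using stable that by blast
      have "\<sigma> u * inverse u \<in> M"
        using \<open>\<sigma> u \<in> T2\<close> that U' by (intro subring_KbarD(4)[OF MR] subfield_KbarD(2)[OF M])
      moreover have "(\<sigma> u / u) ^ n = 1"
        using \<open>\<sigma> u \<in> T2\<close> that lam(2) by (simp add: T2_def power_divide)
      ultimately show "\<sigma> u / u \<in> T1"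
        by (simp add: T1_def divide_inverse)
      show "\<sigma> u = \<sigma> u / u * u"
        using U' that by simp
    qed
    have comm: "\<sigma> (\<tau> u) = \<tau> (\<sigma> u)" if "\<sigma> \<in> A1" "\<tau> \<in> A1" "u \<in> T2" for \<sigma> \<tau> u
    proof -
      note in_A1 = that
      obtain z w where zw: "z \<in> T1" "w \<in> T1" "\<sigma> u = z * u" "\<tau> u = w * u"
        using scale in_A1 by blast
      have \<sigma>\<tau>: "\<sigma> \<in> carrier G" "\<tau> \<in> carrier G" "\<sigma> w = w" "\<tau> z = z" "z \<in> M" "w \<in> M"
        using in_A1 zw(1,2) by (auto simp: A1_def T1_def)
      have u: "u \<in> M"
        using U' in_A1(3) by blast
      show ?thesis
        unfolding zw(3,4) hom(2)[OF \<sigma>\<tau>(1,6) u] hom(2)[OF \<sigma>\<tau>(2,5) u]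
        by (simp only: \<sigma>\<tau>(3,4) zw(3,4) mult.left_commute)
    qed
    show "subgroup A2 G" "derived G A1 \<subseteq> A2"
      using derived_subset_fixing[where H = A1 and T = T2, OF MR KM, folded G_def,
          OF 1(1) T_subset(2)] stable comm
      by (simp_all add: A2_def)
  qed
  have 3: "subgroup A3 G" "derived G A2 \<subseteq> A3"
  proof -
    have sq: "(\<sigma> s)\<^sup>2 = s\<^sup>2" if \<sigma>2: "\<sigma> \<in> A2" and s: "s \<in> T3" for \<sigma> s
    proof -
      have \<sigma>: "\<sigma> \<in> carrier G"
        using that by (simp add: A1_def A2_def)
      obtain u where u: "s \<in> M" "u \<in> T2" "s\<^sup>2 = (r u)\<^sup>2"
        using s by (auto simp: T3_def)
      have \<sigma>u: "\<sigma> u = u"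
        using \<sigma>2 u by (simp add: A2_def)
      have mem: "u ^ (n - 1) \<in> M" "1 \<in> M" "s\<^sup>2 \<in> M" "u + 1 \<in> M"
        using U'(1)[OF u(2)] u(1) subring_KbarD[OF MR] power_in_subring[OF MR] by auto
      have \<sigma>1: "\<sigma> (u + 1) = u + 1" "\<sigma> (u ^ (n - 1) + 1) = u ^ (n - 1) + 1"
        using hom(1)[OF \<sigma> U'(1)[OF u(2)] mem(2)] hom(1)[OF \<sigma> mem(1,2)] pow[OF \<sigma> U'(1)[OF u(2)]]
        by (simp_all only: \<sigma>u fixd(2)[OF \<sigma> lam(1)])
      have "(\<sigma> s)\<^sup>2 * (u + 1) = \<sigma> (s\<^sup>2 * (u + 1))"
        by (simp only: hom(2)[OF \<sigma> mem(3,4)] pow[OF \<sigma> u(1)] \<sigma>1)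
      also have "\<dots> = s\<^sup>2 * (u + 1)"
        by (simp only: u(3) U'(4)[OF u(2)] \<sigma>1)
      finally show ?thesis
        using U'(3)[OF u(2)] by simp
    qed
    have stable: "\<sigma> s \<in> T3" if "\<sigma> \<in> A2" "s \<in> T3" for \<sigma> s
      using that sq[OF that] in_M by (auto simp: T3_def A1_def A2_def)
    have comm: "\<sigma> (\<tau> s) = \<tau> (\<sigma> s)" if "\<sigma> \<in> A2" "\<tau> \<in> A2" "s \<in> T3" for \<sigma> \<tau> s
    proof -
      have "\<sigma> s = s \<or> \<sigma> s = - s" "\<tau> s = s \<or> \<tau> s = - s"
        using sq that power2_eq_iff by blast+
      moreover have "\<sigma> (- s) = - \<sigma> s" "\<tau> (- s) = - \<tau> s"
        using that by (auto simp: T3_def A1_def A2_def intro: neg)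
      ultimately show ?thesis by auto
    qed
    show "subgroup A3 G" "derived G A2 \<subseteq> A3"
      using derived_subset_fixing[where H = A2 and T = T3, OF MR KM, folded G_def,
          OF 2(1) T_subset(3)] stable comm
      by (simp_all add: A3_def)
  qed
  have "A3 \<subseteq> {\<one>\<^bsub>G\<^esub>}"
  proof
    fix \<sigma> assume \<sigma>3: "\<sigma> \<in> A3"
    hence \<sigma>: "\<sigma> \<in> carrier G"
      by (simp add: A1_def A2_def A3_def)
    let ?S = "{x \<in> M. \<sigma> x = x}"
    have "subring ?S Kbar"
      using subring_KbarD[OF MR] hom[OF \<sigma>] neg[OF \<sigma>] fixd(2)[OF \<sigma> lam(1)] by (intro subring_KbarI) auto
    moreover have "K \<subseteq> ?S"
      using KM fixd(1)[OF \<sigma>] by auto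
    moreover have "T2 \<subseteq> ?S"
      using \<sigma>3 U' by (auto simp: A3_def A2_def)
    moreover have "r ` T2 \<subseteq> ?S"
    proof -
      have "r ` T2 \<subseteq> T3"
        using U'(2) by (auto simp: T3_def)
      thus ?thesis
        using \<sigma>3 T_subset(3) by (auto simp: A3_def)
    qed
    ultimately have "M \<subseteq> ?S"
      using gen unfolding T2_def by blast
    hence "\<sigma> = (\<lambda>x\<in>M. x)"
      using \<sigma> Bij_imp_extensional[of \<sigma> M] by (intro extensionalityI[of _ M]) (auto simp: G_def galois_group_simps)
    thus "\<sigma> \<in> {\<one>\<^bsub>G\<^esub>}"
      by (simp add: G_def galois_group_simps)
  qed
  moreover have "(derived G ^^ 3) (carrier G) \<subseteq> A3"
    using mono_derived[OF mono_derived[OF 1(2)]] mono_derived[OF 2(2)] 3(2)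
    by (simp add: numeral_3_eq_3)
  moreover have "\<one>\<^bsub>G\<^esub> \<in> (derived G ^^ 3) (carrier G)"
    using subgroup.one_closed[OF exp_of_derived_is_subgroup[OF subgroup_self]] .
  ultimately have "(derived G ^^ 3) (carrier G) = {\<one>\<^bsub>G\<^esub>}"
    by blast
  thus ?thesis
    using trivial_derived_seq_imp_solvable[OF subgroup_self] unfolding solvable_def G_def by blast
qed

section \<open>The points over the roots of a pure equation\<close>

lemma nth_roots_list:
  fixes lam :: "'a::field_char_0"
  assumes "algebraic_closure (Kbar :: 'a ring) K" and "n > 0" "lam \<noteq> 0"
  obtains us where "distinct us" "set us = {u. u ^ n = lam}" "length us = n"
    "monom 1 n - [:lam:] = (\<Prod>u\<leftarrow>us. [:- u, 1:])"
proof -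
  let ?p = "monom 1 n - [:lam:]"
  have deg: "Polynomial.degree ?p = n"
    using assms(2) by (subst diff_conv_add_uminus, subst degree_add_eq_left) (simp_all add: degree_monom_eq)
  have "lead_coeff ?p = 1"
    unfolding deg using assms(2) by (simp add: coeff_pCons split: nat.split)
  then obtain us where us: "?p = (\<Prod>u\<leftarrow>us. [:- u, 1:])"
    using monic_splits[OF root_ex_algebraic_closure[OF assms(1)]] by blast
  have "poly (\<Prod>u\<leftarrow>us. [:- u, 1:]) x = 0 \<longleftrightarrow> x \<in> set us" for x
    by (induction us) auto
  hence set: "set us = {u. u ^ n = lam}"
    unfolding us[symmetric] by (auto simp: poly_monom)
  have "Polynomial.degree (\<Prod>u\<leftarrow>us. [:- u, 1:]) = length us" and nz: "(\<Prod>u\<leftarrow>us. [:- u, 1:]) \<noteq> 0"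
  proof (induction us)
    case (Cons u us)
    case 1
    show ?case using Cons by (simp add: degree_mult_eq del: mult_pCons_left)
    case 2
    show ?case using Cons by (simp del: mult_pCons_left)
  qed simp_all
  hence len: "length us = n"
    using deg us by simp
  \<comment> \<open>A repeated entry would be a root of the derivative n X^(n-1), hence 0, although
    lam is nonzero.\<close>
  have "distinct us"
  proof (rule ccontr)
    assume "\<not> distinct us"
    then obtain xs ys zs y where "us = xs @ [y] @ ys @ [y] @ zs"
      using not_distinct_decomp by blast
    hence p: "?p = [:- y, 1:] * ([:- y, 1:] * ((\<Prod>u\<leftarrow>xs. [:- u, 1:]) * (\<Prod>u\<leftarrow>ys. [:- u, 1:]) * (\<Prod>u\<leftarrow>zs. [:- u, 1:])))"
      and y: "y \<in> set us"
      unfolding us by (simp_all only: map_append prod_list.append list.map prod_list.Cons prod_list.Nil mult_ac mult_1_right set_append) auto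
    have "poly (pderiv ?p) y = 0"
      unfolding p pderiv_mult by simp
    hence "of_nat n * y ^ (n - 1) = 0"
      by (simp add: pderiv_diff pderiv_monom poly_monom pderiv_pCons)
    hence "y = 0"
      using assms(2) by simp
    thus False
      using y set assms(2,3) by (simp add: power_0_left)
  qed
  with that set len us show ?thesis by blast
qed

lemma nth_roots_power_sums:
  fixes K :: "'a::field_char_0 set"
  assumes K: "subring K Kbar" and "lam \<in> K" and us: "monom 1 n - [:lam:] = (\<Prod>u\<leftarrow>us. [:- u, 1:])"
  shows "power_sum us k \<in> K"
proof (rule coeffs_imp_power_sums[OF K])
  have "poly.coeff (monom 1 n - [:lam:]) k \<in> K" for k
    using subring_KbarD[OF K] \<open>lam \<in> K\<close> by (auto simp: coeff_pCons split: nat.split)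
      (metis add.commute diff_conv_add_uminus)+
  thus "(\<Prod>u\<leftarrow>us. 1 - fps_const u * fps_X) $ k \<in> K" for k
    using coeff_prod_list_in_iff[where S = K and xs = us] subring_KbarD(1)[OF K] unfolding us by blast
qed

lemma coeff_power_in_subring:
  fixes K :: "'a::field_char_0 set"
  assumes K: "subring K Kbar" and q: "\<And>i. poly.coeff q i \<in> K"
  shows "poly.coeff (q ^ j) i \<in> K"
proof (induction j arbitrary: i)
  case 0
  show ?case using subring_KbarD(1,2)[OF K] by (simp add: coeff_1)
next
  case (Suc j)
  show ?case
    unfolding power_Suc coeff_mult by (intro sum_in_subring[OF K] subring_KbarD(4)[OF K] q Suc)
qed

lemma power_sum_poly_image:
  fixes K :: "'a::field_char_0 set"
  assumes K: "subring K Kbar" and us: "\<And>k. power_sum us k \<in> K" and q: "\<And>i. poly.coeff q i \<in> K"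
  shows "(\<Sum>u\<leftarrow>us. poly q u) \<in> K"
proof -
  have "(\<Sum>u\<leftarrow>us. poly q u) = (\<Sum>i\<le>Polynomial.degree q. poly.coeff q i * power_sum us i)"
    unfolding poly_altdef by (simp add: sum_list_sum_swap sum_list_const_mult)
  also have "\<dots> \<in> K"
    by (intro sum_in_subring[OF K] subring_KbarD(4)[OF K] us q)
  finally show ?thesis .
qed

theorem corollary4p2:
  fixes K :: "'a::field_char_0 set" and lam :: 'a and n :: nat and rt :: "'a \<Rightarrow> 'a"
  assumes "number_field K"
    and "algebraic_closure (Kbar :: 'a ring) K"
    and "lam \<in> ring_of_integers K" and "lam \<noteq> 0" and "lam \<noteq> 1"
    and "n \<ge> 4" and "even n"
    and "\<And>u. u ^ n = lam \<Longrightarrow> (rt u)\<^sup>2 = (u ^ (n - 1) + 1) / (u + 1)"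
  shows "\<exists>K'. finite_solvable_ext K K'
      \<and> legendre_point rt ` {u. u ^ n = lam} \<subseteq> rational_points (legendre lam) K'
      \<and> card (legendre_point rt ` {u. u ^ n = lam}) = n
      \<and> ((\<forall>u. u ^ n = lam \<longrightarrow>
            (\<exists>p q. prime_of (root_field K rt u) p \<and> prime_of (root_field K rt u) q
               \<and> \<not> lies_over p 2 \<and> \<not> lies_over q 2
               \<and> p \<inter> \<int> \<noteq> q \<inter> \<int>
               \<and> good_reduction (legendre lam) (root_field K rt u) p
               \<and> good_reduction (legendre lam) (root_field K rt u) q
               \<and> rt u \<in> p \<inter> q
               \<and> u \<notin> p \<union> q \<and> u + 1 \<notin> p \<union> q))
          \<longrightarrow> (\<forall>u. u ^ n = lam \<longrightarrow>
                infinite_order (point_group (legendre lam) K') (legendre_point rt u)))"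
proof -
  let ?U = "{u. u ^ n = lam}"
  interpret cl: algebraic_closure "Kbar :: 'a ring" K
    by fact
  have K: "subfield K Kbar"
    using assms(1) by (simp add: number_field_def)
  note KR = subfield_KbarD(1)[OF K]
  have n: "n > 0"
    using assms(6) by simp
  have lamK: "lam \<in> K" "algebraic_int lam"
    using assms(3) by (simp_all add: ring_of_integers_def)
  obtain us where us: "distinct us" "set us = ?U" "length us = n"
    "monom 1 n - [:lam:] = (\<Prod>u\<leftarrow>us. [:- u, 1:])"
    using nth_roots_list[OF assms(2) n assms(4)] .
  \<comment> \<open>As n is even, u = -1 would give lam = 1.\<close>
  have u_ne: "u \<noteq> 0" "u + 1 \<noteq> 0" if "u \<in> ?U" for u
    using that assms(4,5,7) n by (auto simp: add_eq_0_iff2)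
  have rt: "(rt u)\<^sup>2 * (u + 1) = u ^ (n - 1) + 1" if "u \<in> ?U" for u
    using assms(8) that u_ne(2)[OF that] by simp
  have rt': "u + lam = u * (u + 1) * (rt u)\<^sup>2" if "u \<in> ?U" for u
  proof -
    have "lam = u * u ^ (n - 1)"
      using that n by (cases n) simp_all
    hence "u + lam = u * (u ^ (n - 1) + 1)"
      by (simp add: algebra_simps)
    also have "\<dots> = u * (u + 1) * (rt u)\<^sup>2"
      unfolding rt[OF that, symmetric] by (simp only: mult_ac)
    finally show ?thesis .
  qed
  define gens where "gens = us @ map rt us"
  define K' where "K' = cl.finite_extension K gens"
  have gens: "set gens = ?U \<union> rt ` ?U"
    by (simp add: gens_def us)
  have alg: "(cl.algebraic over K) x" for x
    by (rule cl.algebraic_extension) simp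
  have K': "subfield K' Kbar" "cl.finite_dimension K K'" "K \<subseteq> K'" "set gens \<subseteq> K'"
    unfolding K'_def
    using cl.finite_extension_is_subfield[OF K, of gens] alg cl.finite_extension_finite_dimension(1)[OF K, of gens]
      cl.finite_extension_incl[of K gens] cl.finite_extension_mem[OF KR, of gens] by auto
  \<comment> \<open>Adjoining algebraic elements as a ring already yields a field, so it suffices to
    compare with subrings; \<open>conjugates_in K K'\<close> is only known to be one.\<close>
  have K'_min: "K' \<subseteq> S" if "subring S Kbar" "K \<subseteq> S" "set gens \<subseteq> S" for S
    unfolding K'_def by (rule cl.finite_extension_subring_incl[OF that])
  note K'R = subfield_KbarD(1)[OF K'(1)]
  have "?U \<subseteq> conjugates_in K K'"
    unfolding conjugates_in_def using us(2) gens K'(4) nth_roots_power_sums[OF KR lamK(1) us(4)]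
    by (intro subsetI CollectI exI[of _ us]) auto
  moreover have "rt ` ?U \<subseteq> conjugates_in K K'"
  proof -
    \<comment> \<open>The signs of the chosen roots are arbitrary. With the negatives added, odd
      power sums vanish and even ones depend only on the squares (rt u)^2.\<close>
    let ?xs = "map rt us @ map (\<lambda>u. - rt u) us"
    have "power_sum ?xs k \<in> K" for k
    proof (cases "even k")
      case True
      then obtain j where j: "k = 2 * j"
        by (elim evenE)
      obtain m where m: "n = 2 * m" "m > 0"
        using assms(7) n by (auto elim: evenE)
      \<comment> \<open>This is (X^(n-1) + 1) / (X + 1) with the division carried out. It turns (rt
        u)^2 into the value at u of a polynomial over K, so the even power sums reduce to power sums
        of the roots u.\<close>
      define q :: "'a poly" where "q = (\<Sum>i<n - 1. monom ((- 1) ^ i) i)"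
      have q: "poly q u = (rt u)\<^sup>2" if "u \<in> ?U" for u
      proof -
        have "poly q u = (\<Sum>i<n - 1. (- u) ^ i)"
          by (simp add: q_def poly_sum poly_monom flip: power_mult_distrib)
        hence "(1 + u) * poly q u = 1 - (- u) ^ (n - 1)"
          using one_diff_power_eq[of "- u" "n - 1"] by simp
        also have "\<dots> = u ^ (n - 1) + 1"
          using assms(6,7) by (simp add: power_minus_odd)
        also have "\<dots> = (1 + u) * (rt u)\<^sup>2"
          using rt[OF that] by (simp add: mult.commute add.commute)
        finally show ?thesis
          using u_ne(2)[OF that] by (simp add: add.commute)
      qed
      have "poly.coeff q i \<in> K" for i
        unfolding q_def Polynomial.coeff_sum Polynomial.coeff_monom using subring_KbarD[OF KR]
        by (intro sum_in_subring[OF KR]) (auto intro: power_in_subring[OF KR])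
      note coeff_q = coeff_power_in_subring[OF KR this]
      have "power_sum ?xs k = 2 * (\<Sum>u\<leftarrow>us. (rt u)\<^sup>2 ^ j)"
        by (simp add: j comp_def power_mult)
      also have "(\<Sum>u\<leftarrow>us. (rt u)\<^sup>2 ^ j) = (\<Sum>u\<leftarrow>us. poly (q ^ j) u)"
        using q us(2) by (intro arg_cong[of _ _ sum_list] map_cong) simp_all
      also have "2 * \<dots> \<in> K"
        using power_sum_poly_image[OF KR nth_roots_power_sums[OF KR lamK(1) us(4)] coeff_q]
          of_nat_in_subring[OF KR, of 2] subring_KbarD(4)[OF KR] by simp
      finally show ?thesis .
    next
      case False
      hence "power_sum ?xs k = 0"
        by (simp add: comp_def power_minus_odd flip: sum_list_addf)
      thus ?thesis
        using subring_KbarD(1)[OF KR] by simp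
    qed
    moreover have "set ?xs \<subseteq> K'"
      using gens K'(4) us(2) subring_KbarD(5)[OF K'R] by auto
    moreover have "rt ` ?U \<subseteq> set ?xs"
      using us(2) by auto
    ultimately show ?thesis
      unfolding conjugates_in_def by blast
  qed
  ultimately have "K' \<subseteq> conjugates_in K K'"
    using subring_conjugates_in[OF KR K'R K'(3)] gens by (intro K'_min) auto
  hence "normal_ext K K'"
    by (intro normal_ext_conjugates K alg)
  \<comment> \<open>Being normal, K' is itself one of the fields intersected.\<close>
  hence closure: "galois_closure K K' = K'"
    unfolding galois_closure_def using K'(1) by blast
  have "solvable (galois_group K K')"
  proof (rule solvable_galois_group[OF K'(1,3) lamK(1) assms(4) n])
    show "u \<in> K' \<and> rt u \<in> K' \<and> u + 1 \<noteq> 0 \<and> (rt u)\<^sup>2 * (u + 1) = u ^ (n - 1) + 1" if "u ^ n = lam" for u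
      using rt[of u] u_ne(2)[of u] that gens K'(4) by auto
    show "K' \<subseteq> S" if "subring S Kbar" "K \<subseteq> S" "?U \<subseteq> S" "rt ` ?U \<subseteq> S" for S
      using that gens by (intro K'_min) auto
  qed
  hence ext: "finite_solvable_ext K K'"
    using K K' closure by (simp add: finite_solvable_ext_def finite_ext_def)
  have points: "legendre_point rt u \<in> rational_points (legendre lam) K'" if "u \<in> ?U" for u
  proof -
    have lam: "lam = u * (u + 1) * (rt u)\<^sup>2 - u"
      using rt'[OF that] by (simp add: eq_diff_eq add.commute)
    have "(u * (u + 1) * rt u)\<^sup>2 = u ^ 3 + (1 + lam) * u\<^sup>2 + lam * u"
      unfolding lam by (simp add: algebra_simps power2_eq_square power3_eq_cube)
    moreover have "u \<in> K'" "u * (u + 1) * rt u \<in> K'"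
      using that gens K'(4) by (auto intro!: subring_KbarD[OF K'R])
    ultimately show ?thesis
      by (simp add: rational_points_def legendre_point_def legendre_def)
  qed
  have "card (legendre_point rt ` ?U) = card ?U"
    by (intro card_image inj_onI) (simp add: legendre_point_def)
  hence card: "card (legendre_point rt ` ?U) = n"
    using distinct_card[OF us(1)] us(2,3) by simp
  have "infinite_order (point_group (legendre lam) K') (legendre_point rt u)"
    if hyp: "\<forall>u. u ^ n = lam \<longrightarrow>
            (\<exists>p q. prime_of (root_field K rt u) p \<and> prime_of (root_field K rt u) q
               \<and> \<not> lies_over p 2 \<and> \<not> lies_over q 2
               \<and> p \<inter> \<int> \<noteq> q \<inter> \<int>
               \<and> good_reduction (legendre lam) (root_field K rt u) p
               \<and> good_reduction (legendre lam) (root_field K rt u) q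
               \<and> rt u \<in> p \<inter> q
               \<and> u \<notin> p \<union> q \<and> u + 1 \<notin> p \<union> q)"
      and u: "u ^ n = lam" for u
  proof -
    have int: "v \<in> ring_of_integers (root_field K rt v)" if "v ^ n = lam" for v
    proof -
      have "v \<in> root_field K rt v"
        unfolding root_field_def by (rule generate_field.incl) simp
      moreover have "algebraic_int v"
        using algebraic_int_root[OF lamK(2), of "monom 1 n" v] that n
        by (simp add: poly_monom degree_monom_eq)
      ultimately show ?thesis
        by (simp add: ring_of_integers_def)
    qed
    obtain p q where pq: "prime_of (root_field K rt u) p" "prime_of (root_field K rt u) q"
      "p \<inter> \<int> \<noteq> q \<inter> \<int>" "rt u \<in> p" "rt u \<in> q"
      using hyp u by blast
    have "rt u \<noteq> 0"
    proof
      assume "rt u = 0"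
      hence "u ^ (n - 1) = - 1"
        using rt[of u] u by (simp add: add_eq_0_iff2)
      hence m1: "(- u) ^ (n - 1) = 1"
        using assms(6,7) by (simp add: power_minus_odd)
      have mu: "(- u) ^ n = lam"
        using u assms(7) by simp
      then obtain s where s: "prime_of (root_field K rt (- u)) s" "\<not> lies_over s 2" "rt (- u) \<in> s"
        using hyp by blast
      note D = prime_ofD[OF s(1)]
      \<comment> \<open>As n is even, -u is again a root, and u^(n-1) = -1 becomes (-u)^(n-1) = 1;
        the defining equation at -u then reads (rt (-u))^2 (1 - u) = 2.\<close>
      have "2 = (rt (- u) * (- u + 1)) * rt (- u)"
        using rt[of "- u"] mu m1 by (simp add: power2_eq_square mult_ac)
      also have "\<dots> \<in> s"
        by (rule D(8)[OF D(3)[OF D(5)[OF s(3)] D(2)[OF int[OF mu] D(1)]] s(3)])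
      finally have "lies_over s 2"
        using of_int_in_prime_imp_lies_over[OF s(1), of 2] by simp
      with s(2) show False ..
    qed
    hence "legendre_point rt u [^]\<^bsub>point_group (legendre lam) UNIV\<^esub> k \<noteq> Infinity" if "k > 0" for k :: nat
      unfolding legendre_point_def
      using infinite_order_legendre_point[OF assms(4,5) rt' _ _ _ int pq(1,4,2,5,3) that] u u_ne[of u]
      by (auto simp: add_eq_0_iff2)
    thus ?thesis
      using points[of u] u unfolding infinite_order_def nat_pow_point_group[where F = K']
      by (simp add: point_group_def)
  qed
  thus ?thesis
    using ext points card by (intro exI[of _ K']) blast
qed

end
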